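(* Let $p\in(0,\infty)$. Then the following statements hold. (i) For any $d\in(-\infty,0)$, one has $\mathbb D_{p,\infty,d}^{\mathrm{lower}}=\emptyset$. (ii) $\bigcup_{d\in[0,n)}\mathbb D_{p,\infty,d}^{\mathrm{lower}}=A_{p,\infty}$. (iii) For any $d\in[n,\infty)$, one has $\mathbb D_{p,\infty,d}^{\mathrm{lower}}=A_{p,\infty}$. (iv) For any $d_1,d_2\in[0,n]$ with $d_1<d_2$, one has $\mathbb D_{p,\infty,d_1}^{\mathrm{lower}}\subsetneqq\mathbb D_{p,\infty,d_2}^{\mathrm{lower}}$.
   Context: Fix $m,n\in\mathbb N$. $M_m(\mathbb C)$ is the set of complex $m\times m$ matrices and $\|\cdot\|$ is the operator norm induced by the Euclidean norm of $\mathbb C^m$. A cube in $\mathbb R^n$ has edges parallel to the coordinate axes and finite positive edge length (not necessarily open or closed); $\ell(Q)$ is the edge length of $Q$. $\fint_E f:=\frac1{|E|}\int_E f$, $\log_+t:=\max\{0,\log t\}$. A matrix weight is a function $W:\mathbb R^n\to M_m(\mathbb C)$ such that $W(x)$ is nonnegative definite for every $x$, $W(x)$ is invertible for almost every $x$, and all entries of $W$ are locally integrable. Real powers $W^\alpha(x)$ are defined by the spectral theorem. $A_{p,\infty}=A_{p,\infty}(\mathbb R^n,\mathbb C^m)$ is the class of matrix weights $W$ such that, for every cube $Q$, $\log_+\left(\fint_Q\|W^{1/p}(x)W^{-1/p}(\cdot)\|^p\,dx\right)\in L^1(Q)$, and $[W]_{A_{p,\infty}}:=\sup_Q\exp\left(\fint_Q\log\left(\fint_Q\|W^{1/p}(x)W^{-1/p}(y)\|^p\,dx\right)dy\right)<\infty$.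 For $d\in\mathbb R$, $\mathbb D_{p,\infty,d}^{\mathrm{lower}}=\mathbb D_{p,\infty,d}^{\mathrm{lower}}(\mathbb R^n,\mathbb C^m)$ is the class of matrix weights $W$ ("of $A_{p,\infty}$-lower dimension $d$") for which there is a constant $C>0$ such that, for any cubes $Q,R\subset\mathbb R^n$ with $Q\subset R$, $$\exp\left(\fint_R\log\left(\fint_Q\|W^{1/p}(x)W^{-1/p}(y)\|^p\,dx\right)dy\right)\le C\left[\frac{\ell(R)}{\ell(Q)}\right]^d.$$ *)

theory Defs
  imports "HOL-Analysis.Analysis"
begin

text \<open>Each factor of a cube is an open, closed or half-open interval with end points
  \<open>a $ i\<close> and \<open>a $ i + l\<close>.\<close>

definition cube_of_edge :: "real \<Rightarrow> (real ^ 'n) set \<Rightarrow> bool" where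
  "cube_of_edge l Q \<longleftrightarrow> l > 0 \<and>
     (\<exists>a :: real ^ 'n. \<exists>I :: 'n \<Rightarrow> real set.
        (\<forall>i. {a $ i <..< a $ i + l} \<subseteq> I i \<and> I i \<subseteq> {a $ i .. a $ i + l}) \<and>
        Q = {x. \<forall>i. x $ i \<in> I i})"

definition is_cube :: "(real ^ 'n) set \<Rightarrow> bool" where
  "is_cube Q \<longleftrightarrow> (\<exists>l. cube_of_edge l Q)"

definition edge_length :: "(real ^ 'n) set \<Rightarrow> real" where
  "edge_length Q = (THE l. cube_of_edge l Q)"

lemma cube_of_edge_le:
  assumes "cube_of_edge l Q" and "cube_of_edge l' Q"
  shows "l \<le> l'"
proof (rule ccontr)
  assume less: "\<not> l \<le> l'"
  obtain a I where l: "l > 0"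
    and aI: "\<And>i. {a $ i <..< a $ i + l} \<subseteq> I i" and Q: "Q = {x. \<forall>i. x $ i \<in> I i}"
    using assms(1) unfolding cube_of_edge_def by blast
  obtain b J where l': "l' > 0"
    and bJ: "\<And>i. J i \<subseteq> {b $ i .. b $ i + l'}" and Q': "Q = {x. \<forall>i. x $ i \<in> J i}"
    using assms(2) unfolding cube_of_edge_def by blast
  define e where "e = (l - l') / 3"
  have e: "e > 0" "2 * e < l - l'" "e < l"
    using less l' by (auto simp: e_def)
  define x where "x = (\<chi> i. a $ i + e)"
  define y where "y = (\<chi> i. a $ i + l - e)"
  have "x $ i \<in> I i" "y $ i \<in> I i" for i
    using e l l' by (auto intro!: subsetD[OF aI] simp: x_def y_def)
  then have "x \<in> Q" "y \<in> Q"
    unfolding Q by auto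
  then have "x $ i \<in> {b $ i .. b $ i + l'}" "y $ i \<in> {b $ i .. b $ i + l'}" for i
    using bJ unfolding Q' by blast+
  then have "y $ i - x $ i \<le> l'" for i
    by (smt (verit) atLeastAtMost_iff)
  then show False
    using e by (auto simp: x_def y_def)
qed

lemma edge_length_eq: "cube_of_edge l Q \<Longrightarrow> edge_length Q = l"
  unfolding edge_length_def by (rule the_equality) (auto intro: antisym cube_of_edge_le)

definition conj_transpose :: "complex ^ 'm ^ 'm \<Rightarrow> complex ^ 'm ^ 'm" where
  "conj_transpose A = (\<chi> i j. cnj (A $ j $ i))"

definition unitary :: "complex ^ 'm ^ 'm \<Rightarrow> bool" where
  "unitary U \<longleftrightarrow> U ** conj_transpose U = mat 1 \<and> conj_transpose U ** U = mat 1"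

definition real_diag :: "('m \<Rightarrow> real) \<Rightarrow> complex ^ 'm ^ 'm" where
  "real_diag f = (\<chi> i j. if i = j then complex_of_real (f i) else 0)"

definition nonneg_definite :: "complex ^ 'm ^ 'm \<Rightarrow> bool" where
  "nonneg_definite A \<longleftrightarrow>
     (\<forall>z :: complex ^ 'm. (\<Sum>i\<in>UNIV. cnj (z $ i) * (A *v z) $ i) \<in> \<real>\<^sub>\<ge>\<^sub>0)"

text \<open>Since \<open>0 powr \<alpha> = 0\<close>, a negative power of a singular matrix is a (totalised) value of no
  significance; matrix weights are singular only on a null set. The value does not depend on the
  chosen diagonalisation.\<close>

definition matrix_powr :: "complex ^ 'm ^ 'm \<Rightarrow> real \<Rightarrow> complex ^ 'm ^ 'm" where
  "matrix_powr A \<alpha> = (THE B. \<exists>U lam. unitary U \<and> (\<forall>i. 0 \<le> lam i) \<and>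
      A = U ** real_diag lam ** conj_transpose U \<and>
      B = U ** real_diag (\<lambda>i. lam i powr \<alpha>) ** conj_transpose U)"

definition op_norm :: "complex ^ 'm ^ 'm \<Rightarrow> real" where
  "op_norm A = onorm (\<lambda>z. A *v z)"

definition matrix_weight :: "(real ^ 'n \<Rightarrow> complex ^ 'm ^ 'm) \<Rightarrow> bool" where
  "matrix_weight W \<longleftrightarrow>
     (\<forall>x. nonneg_definite (W x)) \<and>
     (AE x in lebesgue. invertible (W x)) \<and>
     (\<forall>i j K. compact K \<longrightarrow> set_integrable lebesgue K (\<lambda>x. W x $ i $ j))"

text \<open>For a matrix weight this integrand is integrable on cubes, because
  \<open>\<parallel>W\<^sup>1\<^sup>/\<^sup>p(x)\<parallel>\<^sup>p = \<parallel>W(x)\<parallel>\<close>, so the Bochner integral is the genuine one.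
  The average is positive for almost every \<open>y\<close>.\<close>

definition cube_avg ::
  "real \<Rightarrow> (real ^ 'n \<Rightarrow> complex ^ 'm ^ 'm) \<Rightarrow> (real ^ 'n) set \<Rightarrow> real ^ 'n \<Rightarrow> real" where
  "cube_avg p W Q y =
     (LINT x:Q|lebesgue. op_norm (matrix_powr (W x) (1 / p) ** matrix_powr (W y) (- 1 / p)) powr p)
       / measure lebesgue Q"

text \<open>The outer integral of the logarithm may be \<open>+\<infinity>\<close>, in which case the lower dimension condition
  fails; the Bochner integral would be \<open>0\<close> there, so the integral is taken in the extended reals.
  For matrix weights the integral of the negative part is always finite.\<close>

definition ext_integral :: "'a measure \<Rightarrow> 'a set \<Rightarrow> ('a \<Rightarrow> real) \<Rightarrow> ereal" where
  "ext_integral M E f =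
     enn2ereal (\<integral>\<^sup>+ x\<in>E. ennreal (max 0 (f x)) \<partial>M) - enn2ereal (\<integral>\<^sup>+ x\<in>E. ennreal (max 0 (- f x)) \<partial>M)"

definition ext_exp :: "ereal \<Rightarrow> ereal" where
  "ext_exp t = (case t of ereal r \<Rightarrow> ereal (exp r) | PInfty \<Rightarrow> \<infinity> | MInfty \<Rightarrow> 0)"

definition exp_log_avg ::
  "real \<Rightarrow> (real ^ 'n \<Rightarrow> complex ^ 'm ^ 'm) \<Rightarrow> (real ^ 'n) set \<Rightarrow> (real ^ 'n) set \<Rightarrow> ereal" where
  "exp_log_avg p W Q R =
     ext_exp (ext_integral lebesgue R (\<lambda>y. ln (cube_avg p W Q y)) / ereal (measure lebesgue R))"

definition A_p_infty_const :: "real \<Rightarrow> (real ^ 'n \<Rightarrow> complex ^ 'm ^ 'm) \<Rightarrow> ereal" where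
  "A_p_infty_const p W = (SUP Q \<in> {Q. is_cube Q}. exp_log_avg p W Q Q)"

definition A_p_infty :: "real \<Rightarrow> (real ^ 'n \<Rightarrow> complex ^ 'm ^ 'm) set" where
  "A_p_infty p = {W. matrix_weight W \<and>
     (\<forall>Q. is_cube Q \<longrightarrow> set_integrable lebesgue Q (\<lambda>y. max 0 (ln (cube_avg p W Q y)))) \<and>
     A_p_infty_const p W < \<infinity>}"

definition D_lower :: "real \<Rightarrow> real \<Rightarrow> (real ^ 'n \<Rightarrow> complex ^ 'm ^ 'm) set" where
  "D_lower p d = {W. matrix_weight W \<and>
     (\<exists>C::real. C > 0 \<and> (\<forall>Q R. is_cube Q \<longrightarrow> is_cube R \<longrightarrow> Q \<subseteq> R \<longrightarrow>
        exp_log_avg p W Q R \<le> ereal (C * (edge_length R / edge_length Q) powr d)))}"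

end

theory Submission
  imports Defs
begin

text \<open>For a matrix \<open>M\<close> put \<open>g(x) = \<parallel>W\<^sup>1\<^sup>/\<^sup>p(x) M\<parallel>\<^sup>p\<close>. Submultiplicativity of the norm shows that the average
  of \<open>g\<close> over \<open>Q\<close>, divided by \<open>g(y)\<close>, is at most the inner average of the lower dimension condition at
  \<open>y\<close>. Everything follows from this scalar comparison and from the tangent line inequality
  \<open>ln t \<le> t - 1\<close>; no reducing operators and no reverse Hoelder inequality are needed.

  By Jensen's inequality the left-hand side for \<open>Q \<subseteq> R\<close> is at least the ratio of the averages of \<open>g\<close>
  over \<open>Q\<close> and \<open>R\<close>. Repeated halving of \<open>R\<close> yields arbitrarily small \<open>Q\<close> with ratio at least 1, which
  rules out negative \<open>d\<close>.

  If \<open>W\<close> is in \<open>A\<^sub>p\<^sub>,\<^sub>\<infinity>\<close> and \<open>Q \<subseteq> R\<close> has at most half the edge length, then \<open>Q\<close> carries at most a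
  fraction \<open>\<theta> < 1\<close> of the integral of \<open>g\<close> over \<open>R\<close>: otherwise \<open>g\<close> would be tiny on \<open>R - Q\<close> and the
  logarithmic average over \<open>R\<close> too large. Iterating through intermediate cubes and taking
  \<open>M = W\<^sup>-\<^sup>1\<^sup>/\<^sup>p(y)\<close> gives the lower dimension \<open>d = n + log\<^sub>2 \<theta> < n\<close>. Conversely one takes \<open>Q = R\<close>.

  Strictness of the inclusions is witnessed by the weights \<open>\<bar>x\<bar>\<^sup>-\<^sup>a I\<close> with \<open>d\<^sub>1 < a < d\<^sub>2\<close>.\<close>

section \<open>The spectral theorem\<close>

text \<open>The Hermitian form, antilinear on the left. Its real part is the Euclidean inner
  product, so orthogonality can be complex while the extremal argument for eigenvalues stays
  real.\<close>

definition cdot :: "complex ^ 'm \<Rightarrow> complex ^ 'm \<Rightarrow> complex" where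
  "cdot z w = (\<Sum>i\<in>UNIV. cnj (z $ i) * w $ i)"

lemma cdot_add_left: "cdot (z + z') w = cdot z w + cdot z' w"
  and cdot_add_right: "cdot z (w + w') = cdot z w + cdot z w'"
  and cdot_scaleR_left: "cdot (r *\<^sub>R z) w = of_real r * cdot z w"
  and cdot_scaleR_right: "cdot z (r *\<^sub>R w) = of_real r * cdot z w"
  and cdot_smult_left: "cdot (c *s z) w = cnj c * cdot z w"
  and cdot_smult_right: "cdot z (c *s w) = c * cdot z w"
  unfolding cdot_def
  by (simp_all add: algebra_simps sum.distrib sum_distrib_left scaleR_conv_of_real[where 'a = complex])

lemma cnj_cdot: "cnj (cdot z w) = cdot w z"
  unfolding cdot_def by (simp add: mult.commute)

lemma Re_cdot: "Re (cdot z w) = z \<bullet> w"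
  unfolding cdot_def inner_vec_def by (simp add: inner_complex_def)

lemma cdot_self: "cdot z z = of_real ((norm z)\<^sup>2)"
proof (rule complex_eqI)
  have "Im (cdot z z) = - Im (cdot z z)"
    using cnj_cdot[of z z] by (metis cnj.simps(2))
  then show "Im (cdot z z) = Im (of_real ((norm z)\<^sup>2))" by simp
qed (simp add: Re_cdot power2_norm_eq_inner)

lemma matrix_vector_scaleR_complex: "(A :: complex ^ 'm ^ 'k) *v (r *\<^sub>R z) = r *\<^sub>R (A *v z)"
  by (simp add: vec_eq_iff matrix_vector_mult_def scaleR_sum_right)

lemma linear_matrix_vector_complex: "linear (\<lambda>z. (A :: complex ^ 'm ^ 'k) *v z)"
  by (rule linearI) (simp_all add: matrix_vector_right_distrib matrix_vector_scaleR_complex)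

lemma bounded_linear_matrix_vector_complex: "bounded_linear (\<lambda>z. (A :: complex ^ 'm ^ 'k) *v z)"
  using linear_matrix_vector_complex by (simp add: linear_conv_bounded_linear)

lemma nonneg_definite_cdot:
  "nonneg_definite A \<longleftrightarrow> (\<forall>z. cdot z (A *v z) \<in> \<real>\<^sub>\<ge>\<^sub>0)"
  unfolding nonneg_definite_def cdot_def ..

text \<open>Polarisation: reality of the form at \<open>z + w\<close> makes the imaginary parts of
  \<open>\<alpha>\<close> and \<open>\<beta>\<close> cancel, and reality at
  \<open>z + \<i> *s w\<close> makes their real parts agree.\<close>

lemma nonneg_definite_selfadjoint:
  assumes "nonneg_definite A"
  shows "cdot z (A *v w) = cdot (A *v z) w"
proof -
  have q: "Im (cdot z (A *v z)) = 0" for z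
    using assms by (auto simp: nonneg_definite_cdot complex_nonneg_Reals_iff)
  define \<alpha> where "\<alpha> = cdot w (A *v z)"
  define \<beta> where "\<beta> = cdot z (A *v w)"
  have "Im \<alpha> + Im \<beta> = 0"
    using q[of "z + w"] q[of z] q[of w]
    by (simp add: \<alpha>_def \<beta>_def matrix_vector_right_distrib cdot_add_left cdot_add_right)
  moreover have "Re \<beta> = Re \<alpha>"
    using q[of "z + \<i> *s w"] q[of z] q[of w]
    by (simp add: \<alpha>_def \<beta>_def matrix_vector_right_distrib vector_scalar_commute
      cdot_add_left cdot_add_right cdot_smult_left cdot_smult_right)
  ultimately have "\<beta> = cnj \<alpha>"
    by (simp add: complex_eq_iff)
  then show ?thesis
    by (simp add: \<alpha>_def \<beta>_def cnj_cdot)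
qed

text \<open>The conditions for \<open>i \<in> S\<close> are rows of a square matrix whose row
  \<open>j\<close> is zero. That matrix is singular and has a nonzero kernel vector. Indexing the
  vectors by the index type of the space replaces a dimension count.\<close>

lemma ex_orthogonal_vector:
  fixes v :: "'m::finite \<Rightarrow> complex ^ 'm"
  assumes "j \<notin> S"
  shows "\<exists>z. z \<noteq> 0 \<and> (\<forall>i\<in>S. cdot (v i) z = 0)"
proof -
  define B :: "complex ^ 'm ^ 'm" where "B = (\<chi> i k. if i \<in> S then cnj (v i $ k) else 0)"
  have "row j B = 0"
    using assms by (simp add: row_def B_def vec_eq_iff)
  then have "det B = 0"
    by (rule det_zero_row)
  then have "\<not> invertible B"
    by (simp add: invertible_det_nz)
  then obtain z where z: "B *v z = 0" "z \<noteq> 0"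
    using matrix_left_invertible_ker[of B] invertible_left_inverse[of B] by blast
  have "cdot (v i) z = (B *v z) $ i" if "i \<in> S" for i
    using that by (simp add: cdot_def B_def matrix_vector_mult_def)
  then show ?thesis using z by auto
qed

text \<open>Rayleigh's principle on \<open>V\<close>, the orthogonal complement of the eigenvectors
  already found: a maximiser of the quadratic form on the compact unit sphere of \<open>V\<close> is
  an eigenvector. The vector \<open>z1\<close> ensures that this sphere is nonempty.\<close>

lemma ex_eigenvector_orthogonal:
  fixes A :: "complex ^ 'm ^ 'm"
  assumes sa: "\<And>z w. cdot z (A *v w) = cdot (A *v z) w"
    and ev: "\<And>i. i \<in> S \<Longrightarrow> A *v v i = lam i *\<^sub>R v i"
    and nz: "z1 \<noteq> 0" "\<And>i. i \<in> S \<Longrightarrow> cdot (v i) z1 = 0"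
  shows "\<exists>z \<mu>. norm z = 1 \<and> (\<forall>i\<in>S. cdot (v i) z = 0) \<and> A *v z = \<mu> *\<^sub>R z"
proof -
  define V where "V = {z. \<forall>i\<in>S. cdot (v i) z = 0}"
  define q where "q z = z \<bullet> (A *v z)" for z
  have V_scale: "r *\<^sub>R z \<in> V" if "z \<in> V" for r z
    using that by (auto simp: V_def cdot_scaleR_right)
  have V_add: "z + w \<in> V" if "z \<in> V" "w \<in> V" for w z
    using that by (auto simp: V_def cdot_add_right)
  have V_A: "A *v z \<in> V" if "z \<in> V" for z
    using that ev by (auto simp: V_def sa cdot_scaleR_left)
  have contA: "continuous_on UNIV (\<lambda>z. A *v z)"
    by (simp add: linear_continuous_on bounded_linear_matrix_vector_complex)
  have "closed V"
    unfolding V_def cdot_def Collect_ball_eq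
    by (intro closed_INT ballI closed_Collect_eq continuous_intros)
  then have "compact (sphere 0 1 \<inter> V)"
    by (intro compact_Int_closed) auto
  moreover have "(1 / norm z1) *\<^sub>R z1 \<in> sphere 0 1 \<inter> V"
    using nz by (intro IntI V_scale) (auto simp: V_def)
  then have "sphere 0 1 \<inter> V \<noteq> {}" by blast
  moreover have "continuous_on (sphere 0 1 \<inter> V) q"
    unfolding q_def by (intro continuous_intros continuous_on_subset[OF contA]) auto
  ultimately obtain z0 where z0: "z0 \<in> sphere 0 1" "z0 \<in> V"
    and max: "\<And>z. z \<in> sphere 0 1 \<inter> V \<Longrightarrow> q z \<le> q z0"
    using continuous_attains_sup[of "sphere 0 1 \<inter> V" q] by blast
  define \<mu> where "\<mu> = q z0"
  have q_scale: "q (r *\<^sub>R z) = r\<^sup>2 * q z" for r z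
    by (simp add: q_def matrix_vector_scaleR_complex power2_eq_square)
  have qle: "q z \<le> \<mu> * (norm z)\<^sup>2" if "z \<in> V" for z
  proof (cases "z = 0")
    case True
    then show ?thesis by (simp add: q_def)
  next
    case False
    have "q ((1 / norm z) *\<^sub>R z) \<le> \<mu>"
      unfolding \<mu>_def using False that by (intro max IntI V_scale) auto
    then show ?thesis
      using False by (simp add: q_scale power_divide field_simps)
  qed
  have sym: "z \<bullet> (A *v w) = w \<bullet> (A *v z)" for z w
    using sa[of z w] by (metis Re_cdot inner_commute)
  \<comment> \<open>The residual of the eigenvector equation. It lies in \<open>V\<close> because
    \<open>A\<close> maps \<open>V\<close> into itself, so it is an admissible direction of
    variation.\<close>
  define w where "w = A *v z0 - \<mu> *\<^sub>R z0"
  define c where "c = \<mu> * (norm w)\<^sup>2 - q w"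
  have wV: "w \<in> V"
    using V_add[OF V_A[OF z0(2)] V_scale[OF z0(2), of "- \<mu>"]] by (simp add: w_def)
  \<comment> \<open>Maximality at \<open>z0 + t *\<^sub>R w\<close>: the terms of order zero in
    \<open>t\<close> cancel, and the linear coefficient is twice the squared norm of the
    residual.\<close>
  have main: "2 * t * (norm w)\<^sup>2 \<le> t\<^sup>2 * c" for t
  proof -
    have 1: "q (z0 + t *\<^sub>R w) = \<mu> + 2 * t * (w \<bullet> (A *v z0)) + t\<^sup>2 * q w"
      unfolding q_def \<mu>_def
      by (simp add: matrix_vector_right_distrib matrix_vector_scaleR_complex inner_add_left
          inner_add_right sym[of z0 w] power2_eq_square algebra_simps)
    have 2: "(norm (z0 + t *\<^sub>R w))\<^sup>2 = 1 + 2 * t * (w \<bullet> z0) + t\<^sup>2 * (norm w)\<^sup>2"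
    proof -
      have "z0 \<bullet> z0 = 1"
        using z0(1) by (simp add: norm_eq_1)
      then show ?thesis
        unfolding power2_norm_eq_inner
        by (simp add: inner_add_left inner_add_right inner_commute power2_eq_square algebra_simps)
    qed
    have 3: "w \<bullet> (A *v z0) - \<mu> * (w \<bullet> z0) = (norm w)\<^sup>2"
      unfolding power2_norm_eq_inner by (simp add: w_def inner_diff_right inner_diff_left)
    have "q (z0 + t *\<^sub>R w) \<le> \<mu> * (norm (z0 + t *\<^sub>R w))\<^sup>2"
      by (intro qle V_add V_scale wV z0)
    then have "2 * t * (w \<bullet> (A *v z0) - \<mu> * (w \<bullet> z0)) \<le> t\<^sup>2 * c"
      unfolding 1 2 c_def by (simp add: algebra_simps)
    then show ?thesis unfolding 3 .
  qed
  have "(norm w)\<^sup>2 \<le> 0"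
  proof (cases "c \<le> 0")
    case True
    have "2 * (norm w)\<^sup>2 \<le> c" using main[of 1] by simp
    with True show ?thesis by linarith
  next
    case False
    \<comment> \<open>For positive \<open>c\<close> the linear term dominates for small
      \<open>t\<close>, and \<open>t = N / c\<close> is already small enough to force
      \<open>N = 0\<close>.\<close>
    define N where "N = (norm w)\<^sup>2"
    have "2 * (N / c) * N \<le> (N / c)\<^sup>2 * c"
      using main[of "N / c"] by (simp add: N_def)
    also have "(N / c)\<^sup>2 * c = N * N / c"
      using False by (simp add: power2_eq_square)
    finally have "N * N / c \<le> 0" by simp
    then show ?thesis
      using False by (simp add: divide_le_0_iff mult_le_0_iff N_def)
  qed
  then have "A *v z0 = \<mu> *\<^sub>R z0"
    by (simp add: w_def)
  then show ?thesis
    using z0 by (auto simp: V_def)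
qed

text \<open>\<open>S\<close> grows inside the index type. Each new index \<open>k\<close> outside
  \<open>S\<close> leaves room for a vector orthogonal to the earlier ones, which starts the search
  for the next eigenvector.\<close>

lemma ex_orthonormal_eigenvectors:
  fixes A :: "complex ^ 'm ^ 'm" and S :: "'m set"
  assumes sa: "\<And>z w. cdot z (A *v w) = cdot (A *v z) w" and "finite S"
  shows "\<exists>v lam. \<forall>i\<in>S. A *v v i = lam i *\<^sub>R v i \<and> (\<forall>j\<in>S. cdot (v i) (v j) = (if i = j then 1 else 0))"
  using assms(2)
proof induction
  case empty
  then show ?case by simp
next
  case (insert k S)
  then obtain v lam where ev: "\<And>i. i \<in> S \<Longrightarrow> A *v v i = lam i *\<^sub>R v i"
    and on: "\<And>i j. i \<in> S \<Longrightarrow> j \<in> S \<Longrightarrow> cdot (v i) (v j) = (if i = j then 1 else 0)"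
    by blast
  obtain z1 where z1: "z1 \<noteq> 0" "\<And>i. i \<in> S \<Longrightarrow> cdot (v i) z1 = 0"
    using ex_orthogonal_vector[OF insert.hyps(2)] by blast
  have "\<exists>z \<mu>. norm z = 1 \<and> (\<forall>i\<in>S. cdot (v i) z = 0) \<and> A *v z = \<mu> *\<^sub>R z"
    by (rule ex_eigenvector_orthogonal[of A S v lam z1, OF sa ev z1])
  then obtain z \<mu> where z: "norm z = 1" "\<forall>i\<in>S. cdot (v i) z = 0" "A *v z = \<mu> *\<^sub>R z"
    by blast
  have z': "cdot z (v i) = 0" if "i \<in> S" for i
    using z(2) that cnj_cdot[of "v i" z] by simp
  have zz: "cdot z z = 1"
    using z(1) by (simp add: cdot_self)
  show ?case
    using ev on z z' zz insert.hyps(2)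
    by (intro exI[of _ "v(k := z)"] exI[of _ "lam(k := \<mu>)"]) auto
qed

text \<open>The columns of \<open>U\<close> are orthonormal eigenvectors. The last conclusion
  exhibits each eigenvalue as a value of the quadratic form, from which its sign is read off
  later.\<close>

lemma spectral_theorem:
  fixes A :: "complex ^ 'm ^ 'm"
  assumes sa: "\<And>z w. cdot z (A *v w) = cdot (A *v z) w"
  obtains U lam where "unitary U" "A = U ** real_diag lam ** conj_transpose U"
    "\<And>i. \<exists>v. cdot v (A *v v) = of_real (lam i)"
proof -
  obtain v lam where *: "\<forall>i\<in>UNIV :: 'm set. A *v v i = lam i *\<^sub>R v i \<and>
      (\<forall>j\<in>UNIV. cdot (v i) (v j) = (if i = j then 1 else 0))"
    using ex_orthonormal_eigenvectors[of A UNIV, OF sa finite] by (elim exE) (rule that)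
  have ev: "A *v v i = lam i *\<^sub>R v i"
    and on: "cdot (v i) (v j) = (if i = j then 1 else 0)" for i j
    using * by auto
  define U :: "complex ^ 'm ^ 'm" where "U = (\<chi> k i. v i $ k)"
  have UU: "conj_transpose U ** U = mat 1"
    using on by (simp add: vec_eq_iff matrix_matrix_mult_def conj_transpose_def U_def mat_def cdot_def)
  then have UU': "U ** conj_transpose U = mat 1"
    using matrix_left_right_inverse by blast
  have "(A ** U) $ k $ i = (U ** real_diag lam) $ k $ i" for k i
  proof -
    have "(A ** U) $ k $ i = (A *v v i) $ k"
      by (simp add: matrix_matrix_mult_def matrix_vector_mult_def U_def)
    also have "\<dots> = of_real (lam i) * v i $ k"
      by (simp add: ev scaleR_conv_of_real[where 'a = complex])
    also have "\<dots> = (U ** real_diag lam) $ k $ i"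
      by (simp add: matrix_matrix_mult_def U_def real_diag_def if_distrib[of "\<lambda>x. _ * x"] cong: if_cong)
    finally show ?thesis .
  qed
  then have AU: "A ** U = U ** real_diag lam"
    by (simp add: vec_eq_iff)
  have "A = A ** (U ** conj_transpose U)"
    by (simp add: UU')
  also have "\<dots> = U ** real_diag lam ** conj_transpose U"
    by (simp add: matrix_mul_assoc AU)
  finally have "A = U ** real_diag lam ** conj_transpose U" .
  moreover have "\<exists>v. cdot v (A *v v) = of_real (lam i)" for i
    by (rule exI[of _ "v i"]) (simp add: ev cdot_scaleR_right on)
  ultimately show ?thesis
    using that[of U lam] UU UU' by (auto simp: unitary_def)
qed

lemma nonneg_definite_diagonalise:
  assumes "nonneg_definite A"
  obtains U lam where "unitary U" "\<And>i. 0 \<le> lam i" "A = U ** real_diag lam ** conj_transpose U"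
proof -
  obtain U lam where U: "unitary U" "A = U ** real_diag lam ** conj_transpose U"
    "\<And>i. \<exists>v. cdot v (A *v v) = of_real (lam i)"
    using spectral_theorem[OF nonneg_definite_selfadjoint[OF assms]] by metis
  have "0 \<le> lam i" for i
    using U(3)[of i] assms unfolding nonneg_definite_cdot
    by (metis Re_complex_of_real complex_nonneg_Reals_iff)
  then show ?thesis using that U by blast
qed

section \<open>Powers of nonnegative definite matrices\<close>

text \<open>Weierstrass approximation on the growing intervals \<open>{0..real k}\<close> with error
  below \<open>1 / real (Suc k)\<close>. Pointwise limits suffice because a matrix has finitely many
  eigenvalues.\<close>

lemma ex_polynomials_tendsto_powr:
  "\<exists>(N :: nat \<Rightarrow> nat) (c :: nat \<Rightarrow> nat \<Rightarrow> real).
     \<forall>t\<ge>0. (\<lambda>k. \<Sum>i\<le>N k. c k i * t ^ i) \<longlonglongrightarrow> t powr \<alpha>"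
proof -
  \<comment> \<open>Continuous on \<open>[0, \<infinity>)\<close> and zero at \<open>0\<close> for every \<open>\<alpha>\<close>, which matches \<open>0 powr \<alpha> = 0\<close>.\<close>
  define f where "f k t = t * (t + 1 / real (Suc k)) powr (\<alpha> - 1)" for k t
  have "\<exists>N c. \<forall>t\<in>{0..real k}. \<bar>f k t - (\<Sum>i\<le>N. c i * t ^ i)\<bar> < 1 / real (Suc k)" for k
  proof -
    have "continuous_on {0..real k} (f k)"
      unfolding f_def by (intro continuous_intros) (auto simp: add_nonneg_eq_0_iff)
    then obtain g where "real_polynomial_function g"
      "\<And>x. x \<in> {0..real k} \<Longrightarrow> \<bar>f k x - g x\<bar> < 1 / real (Suc k)"
      using Stone_Weierstrass_real_polynomial_function[of "{0..real k}" "f k" "1 / real (Suc k)"]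
      by (metis compact_Icc of_nat_0_less_iff zero_less_Suc zero_less_divide_1_iff)
    then show ?thesis
      unfolding real_polynomial_function_iff_sum by force
  qed
  then obtain N c where
    Nc: "\<And>k t. t \<in> {0..real k} \<Longrightarrow> \<bar>f k t - (\<Sum>i\<le>N k. c k i * t ^ i)\<bar> < 1 / real (Suc k)"
    by metis
  have "(\<lambda>k. \<Sum>i\<le>N k. c k i * t ^ i) \<longlonglongrightarrow> t powr \<alpha>" if "t \<ge> 0" for t
  proof -
    have inv: "(\<lambda>k. 1 / real (Suc k)) \<longlonglongrightarrow> 0"
      using LIMSEQ_inverse_real_of_nat by (simp add: inverse_eq_divide)
    have "(\<lambda>k. f k t) \<longlonglongrightarrow> t powr \<alpha>"
    proof (cases "t = 0")
      case True
      then show ?thesis by (simp add: f_def)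
    next
      case False
      have "(\<lambda>k. f k t) \<longlonglongrightarrow> t * (t + 0) powr (\<alpha> - 1)"
        unfolding f_def using False by (intro tendsto_intros inv) auto
      moreover have "t * (t + 0) powr (\<alpha> - 1) = t powr \<alpha>"
        using False that by (simp add: powr_diff)
      ultimately show ?thesis by simp
    qed
    moreover have "(\<lambda>k. f k t - (\<Sum>i\<le>N k. c k i * t ^ i)) \<longlonglongrightarrow> 0"
    proof (rule tendsto_0_le[OF inv, where K = 1])
      obtain k0 where "t \<le> real k0"
        using real_arch_simple by blast
      then have "t \<in> {0..real k}" if "k \<ge> k0" for k
        using that \<open>t \<ge> 0\<close> by auto
      then show "\<forall>\<^sub>F k in sequentially.
          norm (f k t - (\<Sum>i\<le>N k. c k i * t ^ i)) \<le> norm (1 / real (Suc k)) * 1"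
        using Nc by (intro eventually_sequentiallyI[of k0]) (auto intro: less_imp_le)
    qed
    ultimately have "(\<lambda>k. f k t - (f k t - (\<Sum>i\<le>N k. c k i * t ^ i))) \<longlonglongrightarrow> t powr \<alpha> - 0"
      by (rule tendsto_diff)
    then show ?thesis by simp
  qed
  then show ?thesis by blast
qed

section \<open>Functional calculus for diagonalised matrices\<close>

definition udiag :: "complex ^ 'm ^ 'm \<Rightarrow> ('m \<Rightarrow> real) \<Rightarrow> complex ^ 'm ^ 'm" where
  "udiag U f = U ** real_diag f ** conj_transpose U"

lemma udiag_nth: "udiag U f $ i $ j = (\<Sum>k\<in>UNIV. U $ i $ k * of_real (f k) * cnj (U $ j $ k))"
  by (simp add: udiag_def matrix_matrix_mult_def real_diag_def conj_transpose_def
      if_distrib[of "\<lambda>x. _ * x"] cong: if_cong)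

lemma udiag_mult:
  assumes "unitary U"
  shows "udiag U f ** udiag U g = udiag U (\<lambda>i. f i * g i)"
proof -
  have "real_diag f ** real_diag g = real_diag (\<lambda>i. f i * g i)"
    by (simp add: vec_eq_iff matrix_matrix_mult_def real_diag_def if_distrib[of "\<lambda>x. x * _"]
        if_distrib[of "\<lambda>x. _ * x"] cong: if_cong)
  moreover have "udiag U f ** udiag U g =
      U ** (real_diag f ** (conj_transpose U ** U) ** real_diag g) ** conj_transpose U"
    by (simp add: udiag_def matrix_mul_assoc)
  ultimately show ?thesis
    using assms by (simp add: unitary_def udiag_def)
qed

lemma udiag_one: "unitary (U :: complex ^ 'a ^ 'a) \<Longrightarrow> udiag U (\<lambda>_. 1) = mat 1"
proof -
  have "real_diag (\<lambda>_. 1) = (mat 1 :: complex ^ 'a ^ 'a)"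
    by (simp add: real_diag_def mat_def vec_eq_iff)
  then show "unitary U \<Longrightarrow> udiag U (\<lambda>_. 1) = mat 1"
    by (simp add: udiag_def unitary_def)
qed

lemma tendsto_udiag:
  assumes "\<And>i. ((\<lambda>k. f k i) \<longlongrightarrow> g i) F"
  shows "((\<lambda>k. udiag U (f k)) \<longlongrightarrow> udiag U g) F"
  by (intro vec_tendstoI) (auto simp: udiag_nth intro!: tendsto_intros assms)

definition matrix_power :: "complex ^ 'm ^ 'm \<Rightarrow> nat \<Rightarrow> complex ^ 'm ^ 'm" where
  "matrix_power A i = ((\<lambda>B. A ** B) ^^ i) (mat 1)"

definition matrix_poly :: "nat \<Rightarrow> (nat \<Rightarrow> real) \<Rightarrow> complex ^ 'm ^ 'm \<Rightarrow> complex ^ 'm ^ 'm" where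
  "matrix_poly N c A = (\<Sum>i\<le>N. c i *\<^sub>R matrix_power A i)"

lemma matrix_power_udiag: "unitary U \<Longrightarrow> matrix_power (udiag U f) i = udiag U (\<lambda>j. f j ^ i)"
  by (induction i) (simp_all add: matrix_power_def udiag_one udiag_mult)

lemma matrix_poly_udiag:
  assumes "unitary U"
  shows "matrix_poly N c (udiag U f) = udiag U (\<lambda>j. \<Sum>i\<le>N. c i * f j ^ i)"
proof -
  have "udiag U (\<lambda>j. \<Sum>i\<le>N. c i * f j ^ i) = (\<Sum>i\<le>N. c i *\<^sub>R udiag U (\<lambda>j. f j ^ i))"
  proof (induction N)
    case 0
    then show ?case
      by (simp add: vec_eq_iff udiag_nth sum_distrib_left scaleR_conv_of_real[where 'a = complex] mult_ac)
  next
    case (Suc N)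
    then show ?case
      by (simp add: vec_eq_iff udiag_nth sum_distrib_left sum.distrib algebra_simps scaleR_conv_of_real[where 'a = complex])
  qed
  then show ?thesis
    by (simp add: matrix_poly_def matrix_power_udiag[OF assms])
qed

text \<open>The description in \<open>matrix_powr\<close> is unambiguous: the value obtained from
  any diagonalisation is the limit of one fixed sequence of polynomials in the matrix itself, and
  limits are unique.\<close>

lemma matrix_powr_udiag:
  assumes U: "unitary U" and lam: "\<And>i. 0 \<le> lam i"
  shows "matrix_powr (udiag U lam) \<alpha> = udiag U (\<lambda>i. lam i powr \<alpha>)"
proof -
  obtain N :: "nat \<Rightarrow> nat" and c :: "nat \<Rightarrow> nat \<Rightarrow> real"
    where Nc: "\<And>t. t \<ge> 0 \<Longrightarrow> (\<lambda>k. \<Sum>i\<le>N k. c k i * t ^ i) \<longlonglongrightarrow> t powr \<alpha>"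
    using ex_polynomials_tendsto_powr by blast
  have lim: "(\<lambda>k. matrix_poly (N k) (c k) (udiag V mu)) \<longlonglongrightarrow> udiag V (\<lambda>i. mu i powr \<alpha>)"
    if "unitary V" "\<And>i. 0 \<le> mu i" for V mu
    unfolding matrix_poly_udiag[OF that(1)] by (intro tendsto_udiag Nc that)
  show ?thesis
    unfolding matrix_powr_def
  proof (rule the_equality)
    show "\<exists>V mu. unitary V \<and> (\<forall>i. 0 \<le> mu i) \<and>
      udiag U lam = V ** real_diag mu ** conj_transpose V \<and>
      udiag U (\<lambda>i. lam i powr \<alpha>) = V ** real_diag (\<lambda>i. mu i powr \<alpha>) ** conj_transpose V"
      using assms by (auto simp: udiag_def)
  next
    fix B
    assume "\<exists>V mu. unitary V \<and> (\<forall>i. 0 \<le> mu i) \<and>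
      udiag U lam = V ** real_diag mu ** conj_transpose V \<and>
      B = V ** real_diag (\<lambda>i. mu i powr \<alpha>) ** conj_transpose V"
    then obtain V mu where V: "unitary V" "\<And>i. 0 \<le> mu i"
      "udiag U lam = udiag V mu" "B = udiag V (\<lambda>i. mu i powr \<alpha>)"
      by (auto simp: udiag_def)
    show "B = udiag U (\<lambda>i. lam i powr \<alpha>)"
      unfolding V(4) using lim[of V mu, OF V(1,2)] lim[of U lam, OF assms] unfolding V(3)
      by (rule LIMSEQ_unique)
  qed
qed

lemma nonneg_definite_udiag:
  assumes "nonneg_definite A"
  obtains U lam where "unitary U" "\<And>i. 0 \<le> lam i" "A = udiag U lam"
  by (rule nonneg_definite_diagonalise[OF assms]) (rule that, auto simp: udiag_def)

text \<open>The polynomials do not depend on the matrix, so that powers of measurable functions are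
  measurable.\<close>

lemma ex_matrix_poly_tendsto_matrix_powr:
  "\<exists>N c. \<forall>A :: complex ^ 'm ^ 'm. nonneg_definite A \<longrightarrow>
     (\<lambda>k. matrix_poly (N k) (c k) A) \<longlonglongrightarrow> matrix_powr A \<alpha>"
proof -
  obtain N :: "nat \<Rightarrow> nat" and c :: "nat \<Rightarrow> nat \<Rightarrow> real"
    where Nc: "\<And>t. t \<ge> 0 \<Longrightarrow> (\<lambda>k. \<Sum>i\<le>N k. c k i * t ^ i) \<longlonglongrightarrow> t powr \<alpha>"
    using ex_polynomials_tendsto_powr by blast
  have "(\<lambda>k. matrix_poly (N k) (c k) A) \<longlonglongrightarrow> matrix_powr A \<alpha>"
    if A: "nonneg_definite A" for A :: "complex ^ 'm ^ 'm"
  proof -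
    obtain U lam where U: "unitary U" "\<And>i. 0 \<le> lam i" "A = udiag U lam"
      using nonneg_definite_udiag[OF A] by blast
    show ?thesis
      unfolding U(3) matrix_poly_udiag[OF U(1)] matrix_powr_udiag[OF U(1,2)]
      by (intro tendsto_udiag Nc U)
  qed
  then show ?thesis by blast
qed

lemma continuous_on_matrix_mult [continuous_intros]:
  fixes f g :: "'a::topological_space \<Rightarrow> complex ^ 'm ^ 'm"
  assumes "continuous_on S f" "continuous_on S g"
  shows "continuous_on S (\<lambda>x. f x ** g x)"
  unfolding matrix_matrix_mult_def
  by (intro continuous_on_vec_lambda continuous_on_sum continuous_on_mult
      continuous_on_component assms)

lemma continuous_on_matrix_poly: "continuous_on S (matrix_poly N c)"
proof -
  have "continuous_on S (\<lambda>A. matrix_power A i)" for i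
  proof (induction i)
    case 0
    show ?case by (simp add: matrix_power_def)
  next
    case (Suc i)
    have "matrix_power A (Suc i) = A ** matrix_power A i" for A :: "complex ^ 'a ^ 'a"
      by (simp add: matrix_power_def)
    then show ?case
      using continuous_on_matrix_mult[OF continuous_on_id Suc] by simp
  qed
  then show ?thesis
    unfolding matrix_poly_def[abs_def] by (intro continuous_intros)
qed

lemma borel_measurable_matrix_powr:
  fixes W :: "'a \<Rightarrow> complex ^ 'm ^ 'm"
  assumes W: "W \<in> borel_measurable M" and "\<And>x. nonneg_definite (W x)"
  shows "(\<lambda>x. matrix_powr (W x) \<alpha>) \<in> borel_measurable M"
proof -
  obtain N c where "\<forall>A :: complex ^ 'm ^ 'm. nonneg_definite A \<longrightarrow>
     (\<lambda>k. matrix_poly (N k) (c k) A) \<longlonglongrightarrow> matrix_powr A \<alpha>"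
    using ex_matrix_poly_tendsto_matrix_powr[of \<alpha>] by (elim exE) (rule that)
  then have "(\<lambda>k. matrix_poly (N k) (c k) (W x)) \<longlonglongrightarrow> matrix_powr (W x) \<alpha>" for x
    using assms(2) by metis
  moreover have "(\<lambda>x. matrix_poly (N k) (c k) (W x)) \<in> borel_measurable M" for k
    using W by (rule borel_measurable_continuous_on[OF continuous_on_matrix_poly])
  ultimately show ?thesis
    by (rule borel_measurable_LIMSEQ_metric[rotated])
qed

section \<open>The operator norm\<close>

lemma op_norm_bound: "0 \<le> b \<Longrightarrow> (\<And>z. norm (A *v z) \<le> b * norm z) \<Longrightarrow> op_norm A \<le> b"
  unfolding op_norm_def by (rule onorm_bound)

lemma op_norm_nonneg [simp]: "0 \<le> op_norm A"
  unfolding op_norm_def by (rule onorm_pos_le[OF bounded_linear_matrix_vector_complex])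

lemma op_norm_mult: "op_norm (A ** B) \<le> op_norm A * op_norm B"
  using onorm_compose[OF bounded_linear_matrix_vector_complex[of A]
      bounded_linear_matrix_vector_complex[of B]]
  by (simp add: op_norm_def comp_def matrix_vector_mul_assoc)

lemma op_norm_triangle: "op_norm (A + B) \<le> op_norm A + op_norm B"
  using onorm_triangle[OF bounded_linear_matrix_vector_complex[of A]
      bounded_linear_matrix_vector_complex[of B]]
  by (simp add: op_norm_def matrix_vector_mult_add_rdistrib)

lemma op_norm_pos: "A \<noteq> 0 \<Longrightarrow> 0 < op_norm A"
  unfolding op_norm_def onorm_pos_lt[OF bounded_linear_matrix_vector_complex]
  by (metis matrix_eq matrix_vector_mult_0)

lemma scalar_matrix_vector: "real_diag (\<lambda>_. c) *v z = c *\<^sub>R z"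
  by (simp add: vec_eq_iff matrix_vector_mult_def real_diag_def if_distrib[of "\<lambda>x. x * _"]
      scaleR_conv_of_real[where 'a = complex] cong: if_cong)

lemma op_norm_scalar: "op_norm (real_diag (\<lambda>_. c) :: complex ^ 'm ^ 'm) = \<bar>c\<bar>"
proof -
  have "op_norm (real_diag (\<lambda>_. c) :: complex ^ 'm ^ 'm) = onorm (\<lambda>z :: complex ^ 'm. c *\<^sub>R z)"
    by (simp add: op_norm_def scalar_matrix_vector)
  also have "\<dots> = \<bar>c\<bar>"
    using onorm_scaleR[of "\<lambda>z :: complex ^ 'm. z" c] onorm_id[where 'a = "complex ^ 'm"]
      bounded_linear_ident by simp
  finally show ?thesis .
qed

lemma op_norm_minus: "op_norm (- A) = op_norm A"
proof -
  have "(- A) *v z = - (A *v z)" for z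
    by (simp add: vec_eq_iff matrix_vector_mult_def sum_negf)
  then show ?thesis
    by (simp add: op_norm_def onorm_neg)
qed

text \<open>A crude bound that tends to zero with the entries. Together with the reverse triangle
  inequality it yields continuity of \<open>op_norm\<close>.\<close>

lemma op_norm_le_norm: "op_norm (A :: complex ^ 'm ^ 'm) \<le> (\<Sum>i\<in>UNIV. \<Sum>j\<in>UNIV. norm (A $ i $ j))"
proof (rule op_norm_bound)
  fix z :: "complex ^ 'm"
  have "norm (A *v z) \<le> (\<Sum>i\<in>UNIV. norm ((A *v z) $ i))"
    unfolding norm_vec_def by (rule L2_set_le_sum) simp
  also have "\<dots> \<le> (\<Sum>i\<in>UNIV. \<Sum>j\<in>UNIV. norm (A $ i $ j) * norm z)"
  proof (rule sum_mono)
    fix i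
    have "norm ((A *v z) $ i) \<le> (\<Sum>j\<in>UNIV. norm (A $ i $ j * z $ j))"
      by (simp add: matrix_vector_mult_def norm_sum)
    also have "\<dots> \<le> (\<Sum>j\<in>UNIV. norm (A $ i $ j) * norm z)"
      by (intro sum_mono) (simp add: norm_mult mult_left_mono Finite_Cartesian_Product.norm_nth_le)
    finally show "norm ((A *v z) $ i) \<le> (\<Sum>j\<in>UNIV. norm (A $ i $ j) * norm z)" .
  qed
  finally show "norm (A *v z) \<le> (\<Sum>i\<in>UNIV. \<Sum>j\<in>UNIV. norm (A $ i $ j)) * norm z"
    by (simp add: sum_distrib_right)
qed (simp add: sum_nonneg)

lemma continuous_on_op_norm: "continuous_on S (op_norm :: complex ^ 'm ^ 'm \<Rightarrow> real)"
proof -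
  have diff: "\<bar>op_norm B - op_norm A\<bar> \<le> op_norm (B - A)" for A B :: "complex ^ 'm ^ 'm"
    using op_norm_triangle[of "B - A" A] op_norm_triangle[of "A - B" B] op_norm_minus[of "A - B"]
    by simp
  have "(op_norm \<longlongrightarrow> op_norm A) (at A within S)" for A :: "complex ^ 'm ^ 'm"
  proof -
    have "((\<lambda>B. \<Sum>i\<in>UNIV. \<Sum>j\<in>UNIV. norm ((B - A) $ i $ j)) \<longlongrightarrow>
        (\<Sum>i\<in>UNIV. \<Sum>j\<in>UNIV. norm ((A - A) $ i $ j))) (at A within S)"
      by (intro tendsto_intros)
    then have "((\<lambda>B. \<Sum>i\<in>UNIV. \<Sum>j\<in>UNIV. norm ((B - A) $ i $ j)) \<longlongrightarrow> 0) (at A within S)"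
      by simp
    then have "((\<lambda>B. op_norm B - op_norm A) \<longlongrightarrow> 0) (at A within S)"
      by (rule Lim_null_comparison[rotated])
        (auto intro!: always_eventually order_trans[OF diff op_norm_le_norm]
          simp del: vector_minus_component)
    then show ?thesis
      by (simp add: LIM_zero_iff)
  qed
  then show ?thesis
    by (auto simp: continuous_on_def)
qed

lemma norm_unitary:
  assumes "unitary U"
  shows "norm (U *v z) = norm z" "norm (conj_transpose U *v z) = norm z"
proof -
  have adj: "cdot (A *v z) w = cdot z (conj_transpose A *v w)" for A :: "complex ^ 'a ^ 'a" and z w
    unfolding cdot_def matrix_vector_mult_def conj_transpose_def
    by (simp add: sum_distrib_left sum_distrib_right mult_ac) (rule sum.swap)
  have cc: "conj_transpose (conj_transpose A) = A" for A :: "complex ^ 'a ^ 'a"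
    by (simp add: conj_transpose_def vec_eq_iff)
  have iso: "norm (V *v z) = norm z" if "conj_transpose V ** V = mat 1" for V :: "complex ^ 'a ^ 'a"
  proof -
    have "cdot (V *v z) (V *v z) = cdot z z"
      by (simp add: adj matrix_vector_mul_assoc that)
    then have "(norm (V *v z))\<^sup>2 = (norm z)\<^sup>2"
      unfolding cdot_self by (simp only: of_real_eq_iff)
    then show ?thesis by simp
  qed
  show "norm (U *v z) = norm z" "norm (conj_transpose U *v z) = norm z"
    using assms by (auto intro!: iso simp: unitary_def cc)
qed

lemma op_norm_udiag_le:
  assumes U: "unitary U" and f: "\<And>i. \<bar>f i\<bar> \<le> b"
  shows "op_norm (udiag U f) \<le> b"
proof (rule op_norm_bound)
  \<comment> \<open>The index type is inhabited, so evaluating the hypothesis at an arbitrary index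
    gives the sign of \<open>b\<close>.\<close>
  show b: "0 \<le> b" using f[of undefined] by linarith
  fix z :: "complex ^ 'a"
  define y where "y = conj_transpose U *v z"
  have "norm (udiag U f *v z) = norm (real_diag f *v y)"
    by (simp add: udiag_def y_def norm_unitary[OF U] flip: matrix_vector_mul_assoc)
  also have "\<dots> \<le> norm (b *\<^sub>R y)"
  proof (rule norm_le_componentwise_cart)
    fix i
    have "(real_diag f *v y) $ i = of_real (f i) * y $ i"
      by (simp add: matrix_vector_mult_def real_diag_def if_distrib[of "\<lambda>x. x * _"] cong: if_cong)
    then show "norm ((real_diag f *v y) $ i) \<le> norm ((b *\<^sub>R y) $ i)"
      using f[of i] b by (simp add: norm_mult mult_right_mono)
  qed
  also have "\<dots> = b * norm z"
    using b by (simp add: y_def norm_unitary[OF U])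
  finally show "norm (udiag U f *v z) \<le> b * norm z" .
qed

lemma trace_udiag:
  assumes "unitary U"
  shows "trace (udiag U f) = of_real (\<Sum>i\<in>UNIV. f i)"
proof -
  have "trace (udiag U f) = trace (conj_transpose U ** (U ** real_diag f))"
    unfolding udiag_def by (rule trace_mul_sym)
  also have "\<dots> = trace (real_diag f)"
    using assms by (simp add: matrix_mul_assoc unitary_def)
  finally show ?thesis
    by (simp add: trace_def real_diag_def)
qed

text \<open>The largest eigenvalue is at most the sum of all. The trace is convenient here because
  it is linear in the entries, so that its integrability is immediate for a matrix weight.\<close>

lemma op_norm_root_powr_le_trace:
  assumes A: "nonneg_definite A" and p: "0 < p"
  shows "op_norm (matrix_powr A (1 / p)) powr p \<le> Re (trace A)"
proof -
  obtain U lam where U: "unitary U" "\<And>i. 0 \<le> lam i" "A = udiag U lam"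
    using nonneg_definite_udiag[OF A] by blast
  define T where "T = (\<Sum>i\<in>UNIV. lam i)"
  have T: "Re (trace A) = T"
    by (simp add: U(3) trace_udiag[OF U(1)] T_def)
  have "lam i \<le> T" for i
    unfolding T_def using U(2) by (intro member_le_sum) auto
  then have "op_norm (matrix_powr A (1 / p)) \<le> T powr (1 / p)"
    unfolding U(3) matrix_powr_udiag[OF U(1,2)]
    using U(2) p by (intro op_norm_udiag_le U(1)) (auto intro!: powr_mono2)
  then have "op_norm (matrix_powr A (1 / p)) powr p \<le> (T powr (1 / p)) powr p"
    using p by (intro powr_mono2) auto
  also have "\<dots> = T"
    using p U(2) by (simp add: powr_powr T_def sum_nonneg)
  finally show ?thesis by (simp add: T)
qed

text \<open>Invertibility excludes the eigenvalue 0, where the convention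
  \<open>0 powr x = 0\<close> would spoil the cancellation of exponents.\<close>

lemma matrix_powr_inverse:
  assumes A: "nonneg_definite A" and inv: "invertible A"
  shows "matrix_powr A (- \<alpha>) ** matrix_powr A \<alpha> = mat 1"
proof -
  obtain U lam where U: "unitary U" "\<And>i. 0 \<le> lam i" "A = udiag U lam"
    using nonneg_definite_udiag[OF A] by blast
  have "lam i \<noteq> 0" for i
  proof
    assume i: "lam i = 0"
    obtain B where B: "B ** A = mat 1"
      using inv by (auto simp: invertible_def)
    \<comment> \<open>\<open>udiag U e\<close> projects onto one eigenvector. If its eigenvalue
      vanished, \<open>A\<close> would annihilate the projection, so the projection would be zero,
      yet its trace is 1.\<close>
    define e where "e j = (if j = i then 1 else 0 :: real)" for j
    have "A ** udiag U e = udiag U (\<lambda>_. 0)"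
      unfolding U(3) udiag_mult[OF U(1)] using i by (auto intro!: arg_cong[of _ _ "udiag U"] simp: e_def)
    also have "\<dots> = 0"
      by (simp add: vec_eq_iff udiag_nth)
    finally have "B ** A ** udiag U e = 0"
      by (simp flip: matrix_mul_assoc)
    then have "udiag U e = 0"
      by (simp add: B)
    then show False
      using trace_udiag[OF U(1), of e] by (simp add: e_def trace_def)
  qed
  then show ?thesis
    unfolding U(3) matrix_powr_udiag[OF U(1,2)] udiag_mult[OF U(1)]
    using U(2) by (simp add: udiag_one[OF U(1)] flip: powr_add)
qed

section \<open>Integrals over cubes\<close>

lemma ext_integral_mono_AE:
  assumes "AE x in M. x \<in> E \<longrightarrow> f x \<le> g x"
  shows "ext_integral M E f \<le> ext_integral M E g"
proof -
  have "(\<integral>\<^sup>+ x\<in>E. ennreal (max 0 (f x)) \<partial>M) \<le> (\<integral>\<^sup>+ x\<in>E. ennreal (max 0 (g x)) \<partial>M)"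
    using assms by (intro nn_integral_mono_AE) (auto intro!: ennreal_leI split: split_indicator)
  moreover have "(\<integral>\<^sup>+ x\<in>E. ennreal (max 0 (- g x)) \<partial>M) \<le> (\<integral>\<^sup>+ x\<in>E. ennreal (max 0 (- f x)) \<partial>M)"
    using assms by (intro nn_integral_mono_AE) (auto intro!: ennreal_leI split: split_indicator)
  ultimately show ?thesis
    unfolding ext_integral_def less_eq_ennreal.rep_eq by (rule ereal_minus_mono)
qed

lemma ext_integral_eq_set_integral:
  assumes "set_integrable M E f"
  shows "ext_integral M E f = ereal (LINT x:E|M. f x)"
proof -
  define h where "h x = indicator E x * f x" for x
  have h: "integrable M h"
    using assms by (simp add: set_integrable_def h_def[abs_def])
  have nn: "(\<integral>\<^sup>+ x. ennreal (max 0 (g x)) \<partial>M) = ennreal (\<integral>x. max 0 (g x) \<partial>M)"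
    if "integrable M g" for g :: "'a \<Rightarrow> real"
    using that by (intro nn_integral_eq_integral integrable_max) auto
  have pos: "(\<integral>\<^sup>+ x\<in>E. ennreal (max 0 (f x)) \<partial>M) = ennreal (\<integral>x. max 0 (h x) \<partial>M)"
    unfolding nn[OF h, symmetric]
    by (intro nn_integral_cong) (simp add: h_def split: split_indicator)
  have neg: "(\<integral>\<^sup>+ x\<in>E. ennreal (max 0 (- f x)) \<partial>M) = ennreal (\<integral>x. max 0 (- h x) \<partial>M)"
    unfolding nn[OF integrable_minus[OF h], symmetric]
    by (intro nn_integral_cong) (simp add: h_def split: split_indicator)
  have "(\<integral>x. max 0 (h x) \<partial>M) - (\<integral>x. max 0 (- h x) \<partial>M) = (\<integral>x. max 0 (h x) - max 0 (- h x) \<partial>M)"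
    using h by (intro Bochner_Integration.integral_diff[symmetric]) auto
  also have "\<dots> = (\<integral>x. h x \<partial>M)"
    by (intro Bochner_Integration.integral_cong) auto
  finally show ?thesis
    unfolding ext_integral_def pos neg set_lebesgue_integral_def
    by (simp add: enn2ereal_ennreal integral_nonneg_AE h_def[abs_def])
qed

text \<open>In \<open>ereal\<close> even \<open>\<infinity> - \<infinity>\<close> equals
  \<open>\<infinity>\<close>, so a value below \<open>\<infinity>\<close> forces the integral of the
  positive part to be finite.\<close>

lemma set_integrable_pos_part_if_ext_integral:
  assumes f: "f \<in> borel_measurable M" and E: "E \<in> sets M" and fin: "ext_integral M E f < \<infinity>"
  shows "set_integrable M E (\<lambda>x. max 0 (f x))"
proof -
  have "(\<integral>\<^sup>+ x\<in>E. ennreal (max 0 (f x)) \<partial>M) < \<infinity>"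
    using fin unfolding ext_integral_def
    by (cases "\<integral>\<^sup>+ x\<in>E. ennreal (max 0 (f x)) \<partial>M")
      (auto simp: less_top[symmetric] top_ennreal.rep_eq)
  moreover have "(\<integral>\<^sup>+ x\<in>E. ennreal (max 0 (f x)) \<partial>M)
      = (\<integral>\<^sup>+ x. ennreal (norm (indicator E x *\<^sub>R max 0 (f x))) \<partial>M)"
    by (intro nn_integral_cong) (auto simp: indicator_def)
  ultimately show ?thesis
    unfolding set_integrable_def using f E by (intro integrableI_bounded) auto
qed

lemma ext_exp_le_iff:
  assumes "0 < K"
  shows "ext_exp t \<le> ereal K \<longleftrightarrow> t \<le> ereal (ln K)"
proof (cases t)
  case (real r)
  have "exp r \<le> K \<longleftrightarrow> r \<le> ln K"
    using assms by (simp add: ln_ge_iff)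
  then show ?thesis
    using real by (simp add: ext_exp_def)
qed (use assms in \<open>auto simp: ext_exp_def\<close>)

lemma ext_exp_ge_iff:
  assumes "0 < K"
  shows "ereal K \<le> ext_exp t \<longleftrightarrow> ereal (ln K) \<le> t"
proof (cases t)
  case (real r)
  have "K \<le> exp r \<longleftrightarrow> ln K \<le> r"
    using assms exp_le_cancel_iff[of "ln K" r] by simp
  then show ?thesis
    using real by (simp add: ext_exp_def)
qed (use assms in \<open>auto simp: ext_exp_def\<close>)

lemma exp_log_avg_le_iff:
  assumes "0 < K" "0 < measure lebesgue R"
  shows "exp_log_avg p W Q R \<le> ereal K \<longleftrightarrow>
    ext_integral lebesgue R (\<lambda>y. ln (cube_avg p W Q y)) \<le> ereal (ln K * measure lebesgue R)"
  unfolding exp_log_avg_def ext_exp_le_iff[OF assms(1)]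
  using assms(2) by (simp add: ereal_divide_le_pos mult.commute)

lemma exp_log_avg_ge_iff:
  assumes "0 < K" "0 < measure lebesgue R"
  shows "ereal K \<le> exp_log_avg p W Q R \<longleftrightarrow>
    ereal (ln K * measure lebesgue R) \<le> ext_integral lebesgue R (\<lambda>y. ln (cube_avg p W Q y))"
  unfolding exp_log_avg_def ext_exp_ge_iff[OF assms(1)]
  using assms(2) by (simp add: ereal_le_divide_pos mult.commute)

section \<open>Measure and edge length of cubes\<close>

lemma cube_of_edge_box:
  fixes Q :: "(real ^ 'n) set"
  assumes "cube_of_edge l Q"
  obtains a where "0 < l" "box a (\<chi> i. a $ i + l) \<subseteq> Q" "Q \<subseteq> cbox a (\<chi> i. a $ i + l)"
proof -
  obtain a I where l: "0 < l" and I: "\<And>i. {a $ i <..< a $ i + l} \<subseteq> I i" "\<And>i. I i \<subseteq> {a $ i .. a $ i + l}"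
    and Q: "Q = {x. \<forall>i. x $ i \<in> I i}"
    using assms unfolding cube_of_edge_def by blast
  have "box a (\<chi> i. a $ i + l) \<subseteq> Q"
    unfolding Q by (auto simp: mem_box_cart intro!: subsetD[OF I(1)])
  moreover have "Q \<subseteq> cbox a (\<chi> i. a $ i + l)"
    unfolding Q using subsetD[OF I(2)] by (simp add: mem_box_cart subset_iff)
  ultimately show ?thesis using that l by blast
qed

text \<open>Whichever faces belong to it, a cube differs from its closed box only by a part of the
  frontier, which is negligible.\<close>

lemma cube_measure:
  fixes Q :: "(real ^ 'n) set"
  assumes "cube_of_edge l Q"
  shows "Q \<in> lmeasurable" "measure lebesgue Q = l ^ CARD('n)" "bounded Q"
proof -
  obtain a where l: "0 < l" and Q: "box a (\<chi> i. a $ i + l) \<subseteq> Q" "Q \<subseteq> cbox a (\<chi> i. a $ i + l)"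
    by (rule cube_of_edge_box[OF assms])
  let ?b = "\<chi> i. a $ i + l"
  have neg: "negligible (sym_diff (cbox a ?b) Q)"
    by (rule negligible_subset[OF negligible_frontier_interval[of a ?b]]) (use Q in auto)
  then show "Q \<in> lmeasurable"
    by (rule lmeasurable_negligible_symdiff[OF lmeasurable_cbox])
  have "cbox a ?b \<noteq> {}"
    using l by (auto simp: interval_eq_empty_cart not_less)
  then have "measure lebesgue (cbox a ?b) = l ^ CARD('n)"
    by (simp add: content_cbox_cart)
  then show "measure lebesgue Q = l ^ CARD('n)"
    using measure_negligible_symdiff[OF lmeasurable_cbox neg] by simp
  show "bounded Q"
    using Q(2) bounded_cbox bounded_subset by blast
qed

lemma cube_measure_pos: "cube_of_edge l Q \<Longrightarrow> 0 < measure lebesgue Q"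
  by (simp add: cube_measure(2) cube_of_edge_def)

lemma cube_edge_mono:
  fixes Q R :: "(real ^ 'n) set"
  assumes "cube_of_edge l Q" "cube_of_edge L R" "Q \<subseteq> R"
  shows "l \<le> L"
proof -
  have "l ^ CARD('n) \<le> L ^ CARD('n)"
    using measure_mono_fmeasurable[OF assms(3) _ cube_measure(1)[OF assms(2)]] cube_measure(1)[OF assms(1)]
    unfolding cube_measure(2)[OF assms(1)] cube_measure(2)[OF assms(2)] by (simp add: fmeasurableD)
  moreover have "0 \<le> l" "0 \<le> L"
    using assms by (simp_all add: cube_of_edge_def)
  ultimately show ?thesis
    by (simp add: power_mono_iff)
qed

section \<open>Averages, measurability and integrability of the scalar functions\<close>

definition set_avg :: "(real ^ 'n) set \<Rightarrow> (real ^ 'n \<Rightarrow> real) \<Rightarrow> real" where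
  "set_avg E g = (LINT x:E|lebesgue. g x) / measure lebesgue E"

text \<open>This is the function \<open>g\<close> attached to a matrix \<open>M\<close>. The
  identity matrix serves for lower bounds, and \<open>M = matrix_powr (W y) (- 1 / p)\<close>
  recovers the inner average at \<open>y\<close>.\<close>

definition wnorm :: "real \<Rightarrow> (real ^ 'n \<Rightarrow> complex ^ 'm ^ 'm) \<Rightarrow> complex ^ 'm ^ 'm \<Rightarrow> real ^ 'n \<Rightarrow> real" where
  "wnorm p W M x = op_norm (matrix_powr (W x) (1 / p) ** M) powr p"

lemma cube_avg_eq: "cube_avg p W Q y = set_avg Q (wnorm p W (matrix_powr (W y) (- 1 / p)))"
  by (simp add: cube_avg_def set_avg_def wnorm_def)

lemma wnorm_nonneg [simp]: "0 \<le> wnorm p W M x"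
  by (simp add: wnorm_def)

lemma borel_measurable_vec_iff:
  fixes f :: "'a \<Rightarrow> 'b::euclidean_space ^ 'n"
  shows "f \<in> borel_measurable M \<longleftrightarrow> (\<forall>i. (\<lambda>x. f x $ i) \<in> borel_measurable M)"
proof
  assume "\<forall>i. (\<lambda>x. f x $ i) \<in> borel_measurable M"
  then show "f \<in> borel_measurable M"
    by (subst borel_measurable_euclidean_space)
      (auto simp: Basis_vec_def inner_axis intro!: borel_measurable_inner)
next
  assume "f \<in> borel_measurable M"
  then show "\<forall>i. (\<lambda>x. f x $ i) \<in> borel_measurable M"
    by (auto intro!: borel_measurable_continuous_on[of "\<lambda>v. v $ _"] continuous_intros)
qed

text \<open>Integrability on balls makes the truncations of the entries measurable, and at each
  point the truncations are eventually equal to the entries.\<close>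

lemma matrix_weight_measurable:
  fixes W :: "real ^ 'n \<Rightarrow> complex ^ 'm ^ 'm"
  assumes "matrix_weight W"
  shows "W \<in> borel_measurable lebesgue"
proof -
  have "(\<lambda>x. W x $ i $ j) \<in> borel_measurable lebesgue" for i j
  proof (rule borel_measurable_LIMSEQ_metric)
    fix k :: nat
    have "set_integrable lebesgue (cball 0 (real k)) (\<lambda>x. W x $ i $ j)"
      using assms by (simp add: matrix_weight_def)
    then show "(\<lambda>x. indicator (cball 0 (real k)) x *\<^sub>R W x $ i $ j) \<in> borel_measurable lebesgue"
      by (auto simp: set_integrable_def)
  next
    fix x :: "real ^ 'n"
    obtain k0 :: nat where "norm x \<le> real k0"
      using real_arch_simple by blast
    then have "\<forall>\<^sub>F k in sequentially. indicator (cball 0 (real k)) x *\<^sub>R W x $ i $ j = W x $ i $ j"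
      by (intro eventually_sequentiallyI[of k0]) auto
    then show "(\<lambda>k. indicator (cball 0 (real k)) x *\<^sub>R W x $ i $ j) \<longlonglongrightarrow> W x $ i $ j"
      by (rule tendsto_eventually)
  qed
  then show ?thesis
    by (simp add: borel_measurable_vec_iff)
qed

lemma continuous_on_wnorm_arg:
  assumes "0 < p"
  shows "continuous_on UNIV (\<lambda>B :: (complex ^ 'm ^ 'm) \<times> (complex ^ 'm ^ 'm). op_norm (fst B ** snd B) powr p)"
  using assms
  by (intro continuous_on_powr' continuous_on_compose2[OF continuous_on_op_norm[of UNIV]]
      continuous_on_matrix_mult continuous_intros) auto

lemma wnorm_measurable:
  assumes W: "matrix_weight W" and p: "0 < p"
  shows "wnorm p W M \<in> borel_measurable lebesgue"
proof -
  have "(\<lambda>x. matrix_powr (W x) (1 / p)) \<in> borel_measurable lebesgue"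
    using W by (intro borel_measurable_matrix_powr matrix_weight_measurable)
      (auto simp: matrix_weight_def)
  then show ?thesis
    unfolding wnorm_def[abs_def]
    by (rule borel_measurable_continuous_Pair[OF _ borel_measurable_const])
      (rule continuous_on_wnorm_arg[OF p])
qed

text \<open>Dominated by a constant multiple of the trace of \<open>W\<close>, which is integrable
  on the compact closure of \<open>E\<close>.\<close>

lemma wnorm_integrable:
  fixes W :: "real ^ 'n \<Rightarrow> complex ^ 'm ^ 'm"
  assumes W: "matrix_weight W" and p: "0 < p" and E: "E \<in> lmeasurable" "bounded E"
  shows "set_integrable lebesgue E (wnorm p W M)"
proof -
  have "set_integrable lebesgue E (\<lambda>x. W x $ i $ i)" for i
  proof (rule set_integrable_subset)
    have "compact (closure E)"
      using E(2) by (simp add: compact_closure)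
    then show "set_integrable lebesgue (closure E) (\<lambda>x. W x $ i $ i)"
      using W by (simp add: matrix_weight_def)
  qed (use E closure_subset in auto)
  then have "integrable lebesgue (\<lambda>x. of_real (op_norm M powr p) * (\<Sum>i\<in>UNIV. indicator E x *\<^sub>R W x $ i $ i))"
    unfolding set_integrable_def
    by (intro integrable_mult_right Bochner_Integration.integrable_sum) auto
  then have "set_integrable lebesgue E (\<lambda>x. of_real (op_norm M powr p) * trace (W x))"
    by (simp add: set_integrable_def trace_def scaleR_sum_right mult_scaleR_right flip: scaleR_sum_right)
  then show ?thesis
  proof (rule set_integrable_bound)
    show "set_borel_measurable lebesgue E (wnorm p W M)"
      unfolding set_borel_measurable_def
      using wnorm_measurable[OF W p] E by (intro borel_measurable_scaleR borel_measurable_indicator) auto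
    have "wnorm p W M x \<le> norm (of_real (op_norm M powr p) * trace (W x))" for x
    proof -
      have "wnorm p W M x \<le> (op_norm (matrix_powr (W x) (1 / p)) * op_norm M) powr p"
        unfolding wnorm_def using p by (intro powr_mono2 op_norm_mult) auto
      also have "\<dots> = op_norm (matrix_powr (W x) (1 / p)) powr p * op_norm M powr p"
        by (simp add: powr_mult)
      also have "\<dots> \<le> Re (trace (W x)) * op_norm M powr p"
        using W p by (intro mult_right_mono op_norm_root_powr_le_trace) (auto simp: matrix_weight_def)
      also have "\<dots> \<le> norm (trace (W x)) * op_norm M powr p"
        by (intro mult_right_mono complex_Re_le_cmod) auto
      finally show ?thesis by (simp add: norm_mult mult.commute)
    qed
    then show "AE x in lebesgue. x \<in> E \<longrightarrow> norm (wnorm p W M x)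
        \<le> norm (of_real (op_norm M powr p) * trace (W x))"
      by simp
  qed
qed

text \<open>The integrand is jointly measurable in both points. Passing to the finite measure
  \<open>lebesgue_on Q\<close> makes the theorem on integrals with a parameter applicable.\<close>

lemma cube_avg_measurable:
  fixes W :: "real ^ 'n \<Rightarrow> complex ^ 'm ^ 'm"
  assumes W: "matrix_weight W" and p: "0 < p" and Q: "Q \<in> lmeasurable"
  shows "cube_avg p W Q \<in> borel_measurable lebesgue"
proof -
  interpret finite_measure "lebesgue_on Q"
    using Q by (rule finite_measure_lebesgue_on)
  have m: "(\<lambda>x. matrix_powr (W x) a) \<in> borel_measurable lebesgue" for a
    using W by (intro borel_measurable_matrix_powr matrix_weight_measurable)
      (auto simp: matrix_weight_def)
  have 1: "(\<lambda>z. matrix_powr (W (snd z)) (1 / p)) \<in> borel_measurable (lebesgue \<Otimes>\<^sub>M lebesgue_on Q)"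
    by (rule measurable_compose[OF measurable_snd measurable_restrict_space1[OF m]])
  have 2: "(\<lambda>z. matrix_powr (W (fst z)) (- 1 / p)) \<in> borel_measurable (lebesgue \<Otimes>\<^sub>M lebesgue_on Q)"
    by (rule measurable_compose[OF measurable_fst m])
  have "(\<lambda>z. op_norm (matrix_powr (W (snd z)) (1 / p) ** matrix_powr (W (fst z)) (- 1 / p)) powr p)
      \<in> borel_measurable (lebesgue \<Otimes>\<^sub>M lebesgue_on Q)"
    by (rule borel_measurable_continuous_Pair[OF 1 2 continuous_on_wnorm_arg[OF p]])
  then have "(\<lambda>y. \<integral>x. op_norm (matrix_powr (W x) (1 / p) ** matrix_powr (W y) (- 1 / p)) powr p \<partial>lebesgue_on Q)
      \<in> borel_measurable lebesgue"
    by (intro borel_measurable_lebesgue_integral) (simp add: case_prod_beta')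
  then show ?thesis
    using Q unfolding cube_avg_def[abs_def] set_lebesgue_integral_def
    by (subst (asm) integral_restrict_space) (auto simp: fmeasurable_def)
qed

section \<open>The scalar comparison\<close>

lemma matrix_weight_AE_invertible: "matrix_weight W \<Longrightarrow> AE x in lebesgue. invertible (W x)"
  and matrix_weight_nonneg: "matrix_weight W \<Longrightarrow> nonneg_definite (W x)"
  by (simp_all add: matrix_weight_def)

text \<open>Insert the product of the powers of \<open>W z\<close> with exponents
  \<open>- 1 / p\<close> and \<open>1 / p\<close>, which is the identity, in front of
  \<open>M\<close> and use submultiplicativity. This is the only link between matrices and scalar
  functions in the estimates.\<close>

lemma wnorm_le_mult:
  assumes W: "matrix_weight W" and p: "0 < p" and inv: "invertible (W z)"
  shows "wnorm p W M x \<le> wnorm p W (matrix_powr (W z) (- 1 / p)) x * wnorm p W M z"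
proof -
  let ?A = "matrix_powr (W x) (1 / p)" and ?B = "matrix_powr (W z) (- 1 / p)"
    and ?C = "matrix_powr (W z) (1 / p)"
  have BC: "?B ** ?C = mat 1"
    using matrix_powr_inverse[OF matrix_weight_nonneg[OF W] inv, of "1 / p"] by simp
  have "?A ** M = ?A ** (?B ** ?C) ** M"
    unfolding BC by simp
  also have "\<dots> = (?A ** ?B) ** (?C ** M)"
    by (simp add: matrix_mul_assoc)
  finally have "op_norm (?A ** M) \<le> op_norm (?A ** ?B) * op_norm (?C ** M)"
    by (simp only: op_norm_mult)
  then have "op_norm (?A ** M) powr p \<le> (op_norm (?A ** ?B) * op_norm (?C ** M)) powr p"
    using p by (intro powr_mono2) auto
  then show ?thesis
    by (simp add: wnorm_def powr_mult)
qed

lemma wnorm_pos: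
  assumes W: "matrix_weight W" and inv: "invertible (W x)" and M: "M \<noteq> 0"
  shows "0 < wnorm p W M x"
proof -
  have 1: "matrix_powr (W x) (- (1 / p)) ** matrix_powr (W x) (1 / p) = mat 1"
    by (rule matrix_powr_inverse[OF matrix_weight_nonneg[OF W] inv])
  have "matrix_powr (W x) (1 / p) ** M \<noteq> 0"
  proof
    assume "matrix_powr (W x) (1 / p) ** M = 0"
    then have "matrix_powr (W x) (- (1 / p)) ** matrix_powr (W x) (1 / p) ** M = 0"
      by (simp flip: matrix_mul_assoc)
    with M show False unfolding 1 by simp
  qed
  then show ?thesis
    using op_norm_pos unfolding wnorm_def by fastforce
qed

lemma matrix_powr_nonzero:
  fixes W :: "real ^ 'n \<Rightarrow> complex ^ 'm ^ 'm"
  assumes W: "matrix_weight W" and inv: "invertible (W x)"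
  shows "matrix_powr (W x) a \<noteq> 0"
proof
  assume 0: "matrix_powr (W x) a = 0"
  have "matrix_powr (W x) (- a) ** matrix_powr (W x) a = mat 1"
    by (rule matrix_powr_inverse[OF matrix_weight_nonneg[OF W] inv])
  then have "(mat 1 :: complex ^ 'm ^ 'm) = 0"
    unfolding 0 by simp
  then show False
    by (metis matrix_vector_mul_lid matrix_vector_mult_0 zero_neq_one vec_eq_iff one_index zero_index)
qed

lemma wnorm_integrable_cube:
  "matrix_weight W \<Longrightarrow> 0 < p \<Longrightarrow> cube_of_edge l Q \<Longrightarrow> set_integrable lebesgue Q (wnorm p W M)"
  by (intro wnorm_integrable cube_measure)

text \<open>A vanishing integral would make the integrand vanish almost everywhere on
  \<open>Q\<close>, while it is positive almost everywhere; then \<open>Q\<close> would be a null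
  set.\<close>

lemma set_integral_wnorm_pos:
  assumes W: "matrix_weight W" and p: "0 < p" and Q: "cube_of_edge l Q" and M: "M \<noteq> 0"
  shows "0 < (LINT x:Q|lebesgue. wnorm p W M x)"
proof -
  have int: "integrable lebesgue (\<lambda>x. indicator Q x *\<^sub>R wnorm p W M x)"
    using wnorm_integrable_cube[OF W p Q] by (simp add: set_integrable_def)
  have "(LINT x:Q|lebesgue. wnorm p W M x) \<noteq> 0"
  proof
    assume "(LINT x:Q|lebesgue. wnorm p W M x) = 0"
    then have "AE x in lebesgue. indicator Q x *\<^sub>R wnorm p W M x = 0"
      unfolding set_lebesgue_integral_def
      by (subst (asm) integral_nonneg_eq_0_iff_AE[OF int]) auto
    with matrix_weight_AE_invertible[OF W] have "AE x in lebesgue. x \<notin> Q"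
    proof eventually_elim
      case (elim x)
      then show ?case
        using wnorm_pos[OF W elim(1) M, of p] by (auto split: split_indicator_asm)
    qed
    then have "Q \<in> null_sets lebesgue"
      using cube_measure(1)[OF Q] by (simp add: AE_iff_null_sets fmeasurableD)
    then show False
      using cube_measure_pos[OF Q] by (simp add: measure_eq_0_null_sets)
  qed
  moreover have "0 \<le> (LINT x:Q|lebesgue. wnorm p W M x)"
    unfolding set_lebesgue_integral_def by (rule integral_nonneg_AE) auto
  ultimately show ?thesis by simp
qed

lemma set_avg_wnorm_pos:
  assumes "matrix_weight W" "0 < p" "cube_of_edge l Q" "M \<noteq> 0"
  shows "0 < set_avg Q (wnorm p W M)"
  using set_integral_wnorm_pos[OF assms] cube_measure_pos[OF assms(3)] by (simp add: set_avg_def)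

lemma set_avg_wnorm_le:
  assumes W: "matrix_weight W" and p: "0 < p" and Q: "cube_of_edge l Q" and inv: "invertible (W z)"
  shows "set_avg Q (wnorm p W M) \<le> cube_avg p W Q z * wnorm p W M z"
proof -
  let ?B = "matrix_powr (W z) (- 1 / p)"
  have "(LINT x:Q|lebesgue. wnorm p W M x) \<le> (LINT x:Q|lebesgue. wnorm p W ?B x * wnorm p W M z)"
  proof (rule set_integral_mono)
    show "set_integrable lebesgue Q (\<lambda>x. wnorm p W ?B x * wnorm p W M z)"
      using wnorm_integrable_cube[OF W p Q] by (intro set_integrable_mult_left) auto
  qed (simp_all only: wnorm_le_mult[where M = M, OF W p inv] wnorm_integrable_cube[OF W p Q])
  also have "\<dots> = (LINT x:Q|lebesgue. wnorm p W ?B x) * wnorm p W M z"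
    by simp
  finally show ?thesis
    using cube_measure_pos[OF Q] by (simp add: cube_avg_eq set_avg_def divide_simps)
qed

lemma ext_integral_ge:
  assumes "set_integrable lebesgue R h" "AE z in lebesgue. z \<in> R \<longrightarrow> h z \<le> f z"
  shows "ereal (LINT z:R|lebesgue. h z) \<le> ext_integral lebesgue R f"
  using ext_integral_mono_AE[OF assms(2)] ext_integral_eq_set_integral[OF assms(1)] by simp

lemma set_integrable_const_lmeasurable:
  assumes "S \<in> lmeasurable"
  shows "set_integrable lebesgue S (\<lambda>_. c :: real)"
  unfolding set_integrable_def
  by (intro integrable_scaleR_left integrable_real_indicator)
    (use fmeasurableD[OF assms] fmeasurableD2[OF assms] in \<open>auto simp: less_top\<close>)

lemma set_integral_const_lmeasurable:
  assumes "S \<in> lmeasurable"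
  shows "(LINT x:S|lebesgue. c :: real) = c * measure lebesgue S"
proof -
  have "(LINT x:S|lebesgue. c) = (\<integral>x. c * indicator S x \<partial>lebesgue)"
    unfolding set_lebesgue_integral_def by (simp add: mult.commute)
  then show ?thesis
    using fmeasurableD[OF assms] by simp
qed

text \<open>The tangent line inequality is applied to \<open>wnorm p W M z / b\<close>. The base
  point \<open>b\<close> is left free, and the minorant is affine in \<open>wnorm p W M z\<close>,
  hence integrable on cubes.\<close>

lemma ln_cube_avg_ge:
  assumes W: "matrix_weight W" and p: "0 < p" and Q: "cube_of_edge l Q" and M: "M \<noteq> 0"
    and inv: "invertible (W z)" and b: "0 < b"
  shows "ln (set_avg Q (wnorm p W M) / b) + 1 - wnorm p W M z / b \<le> ln (cube_avg p W Q z)"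
proof -
  define a where "a = set_avg Q (wnorm p W M)"
  define g where "g = wnorm p W M z"
  have a: "0 < a" unfolding a_def by (rule set_avg_wnorm_pos[OF W p Q M])
  have g: "0 < g" unfolding g_def by (rule wnorm_pos[OF W inv M])
  have "a / g \<le> cube_avg p W Q z"
    using set_avg_wnorm_le[OF W p Q inv, of M] g by (simp add: a_def g_def divide_simps)
  then have "ln (a / g) \<le> ln (cube_avg p W Q z)"
    using a g by (intro ln_mono) auto
  moreover have "ln (a / g) = ln (a / b) - ln (g / b)"
    using a g b by (simp add: ln_div)
  moreover have "ln (g / b) \<le> g / b - 1"
    using g b by (intro ln_le_minus_one) auto
  ultimately show ?thesis
    by (simp add: a_def g_def)
qed

text \<open>With \<open>b\<close> the average of \<open>g\<close> over \<open>R\<close>, the part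
  \<open>1 - g z / b\<close> of the affine minorant has integral zero over \<open>R\<close>, and
  only the logarithm of the ratio survives.\<close>

lemma exp_log_avg_ge:
  assumes W: "matrix_weight W" and p: "0 < p" and Q: "cube_of_edge l Q" and R: "cube_of_edge L R"
    and M: "M \<noteq> 0"
  shows "ereal (set_avg Q (wnorm p W M) / set_avg R (wnorm p W M)) \<le> exp_log_avg p W Q R"
proof -
  define g where "g = wnorm p W M"
  define b where "b = set_avg R g"
  define c where "c = ln (set_avg Q g / b)"
  have a: "0 < set_avg Q g" and b: "0 < b"
    unfolding b_def g_def by (rule set_avg_wnorm_pos[OF W p _ M], fact)+
  have mR: "0 < measure lebesgue R" by (rule cube_measure_pos[OF R])
  have g: "set_integrable lebesgue R g"
    unfolding g_def by (rule wnorm_integrable_cube[OF W p R])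
  have const: "set_integrable lebesgue R (\<lambda>_. c + 1)"
    by (rule set_integrable_const_lmeasurable[OF cube_measure(1)[OF R]])
  have int: "set_integrable lebesgue R (\<lambda>z. c + 1 - g z / b)"
    using g const b by (intro set_integral_diff) auto
  have le: "AE z in lebesgue. z \<in> R \<longrightarrow> c + 1 - g z / b \<le> ln (cube_avg p W Q z)"
    using matrix_weight_AE_invertible[OF W]
  proof eventually_elim
    case (elim z)
    show ?case
      using ln_cube_avg_ge[OF W p Q M elim b] by (simp add: c_def g_def)
  qed
  have "(LINT z:R|lebesgue. c + 1 - g z / b) = (LINT z:R|lebesgue. c + 1) - (LINT z:R|lebesgue. g z / b)"
    using g b by (intro set_integral_diff const) auto
  also have "\<dots> = c * measure lebesgue R"
    using b mR unfolding set_integral_const_lmeasurable[OF cube_measure(1)[OF R]]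
    by (simp add: b_def set_avg_def field_simps)
  finally have "ereal (c * measure lebesgue R) = ereal (LINT z:R|lebesgue. c + 1 - g z / b)"
    by simp
  also have "\<dots> \<le> ext_integral lebesgue R (\<lambda>y. ln (cube_avg p W Q y))"
    by (rule ext_integral_ge[OF int le])
  finally show ?thesis
    using a b mR by (subst exp_log_avg_ge_iff) (auto simp: c_def b_def g_def)
qed

section \<open>Self-improvement\<close>

lemma intermediate_cube:
  fixes Q R :: "(real ^ 'n) set"
  assumes Q: "cube_of_edge l Q" and R: "cube_of_edge L R" and QR: "Q \<subseteq> R" and lL: "2 * l \<le> L"
  obtains S where "cube_of_edge (L / 2) S" "Q \<subseteq> S" "S \<subseteq> R"
proof -
  obtain a where l: "0 < l" and a: "box a (\<chi> i. a $ i + l) \<subseteq> Q" "Q \<subseteq> cbox a (\<chi> i. a $ i + l)"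
    by (rule cube_of_edge_box[OF Q])
  obtain b J where L: "0 < L" and J: "\<And>i. {b $ i <..< b $ i + L} \<subseteq> J i" "\<And>i. J i \<subseteq> {b $ i .. b $ i + L}"
    and R_eq: "R = {x. \<forall>i. x $ i \<in> J i}"
    using R unfolding cube_of_edge_def by blast
  have "R \<subseteq> cbox b (\<chi> i. b $ i + L)"
    unfolding R_eq using subsetD[OF J(2)] by (simp add: mem_box_cart subset_iff)
  \<comment> \<open>The inner box of \<open>Q\<close> is open; passing to closures gives the
    comparison of the corners.\<close>
  then have "closure (box a (\<chi> i. a $ i + l)) \<subseteq> cbox b (\<chi> i. b $ i + L)"
    using a(1) QR by (intro closure_minimal) auto
  moreover have "box a (\<chi> i. a $ i + l) \<noteq> {}"
    using l by (auto simp: interval_eq_empty_cart not_le)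
  ultimately have sub: "cbox a (\<chi> i. a $ i + l) \<subseteq> cbox b (\<chi> i. b $ i + L)"
    by (simp add: closure_box)
  have "a \<in> cbox a (\<chi> i. a $ i + l)" "(\<chi> i. a $ i + l) \<in> cbox a (\<chi> i. a $ i + l)"
    using l by (simp_all add: mem_box_cart)
  then have "a \<in> cbox b (\<chi> i. b $ i + L)" "(\<chi> i. a $ i + l) \<in> cbox b (\<chi> i. b $ i + L)"
    using sub by blast+
  then have ab: "b $ i \<le> a $ i" "a $ i + l \<le> b $ i + L" for i
    by (simp_all add: mem_box_cart)
  \<comment> \<open>The lowest corner for which the window of edge \<open>L / 2\<close> stays above
    the lower faces of \<open>R\<close> and still reaches the upper faces of \<open>Q\<close>. It is
    below \<open>a\<close> because \<open>l \<le> L / 2\<close>.\<close>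
  define c where "c = (\<chi> i. max (b $ i) (a $ i + l - L / 2))"
  have c: "b $ i \<le> c $ i" "c $ i + L / 2 \<le> b $ i + L" "c $ i \<le> a $ i" "a $ i + l \<le> c $ i + L / 2" for i
    using ab[of i] lL L by (auto simp: c_def)
  \<comment> \<open>Closed intervals catch \<open>Q\<close> whichever of its faces it contains;
    intersecting with \<open>J i\<close> keeps the cube inside \<open>R\<close>.\<close>
  define S where "S = {x. \<forall>i. x $ i \<in> J i \<inter> {c $ i .. c $ i + L / 2}}"
  have "{c $ i <..< c $ i + L / 2} \<subseteq> J i \<inter> {c $ i .. c $ i + L / 2}" for i
    using c[of i] by (auto intro!: subsetD[OF J(1)])
  then have "cube_of_edge (L / 2) S"
    unfolding cube_of_edge_def S_def using L
    by (intro conjI exI[of _ c] exI[of _ "\<lambda>i. J i \<inter> {c $ i .. c $ i + L / 2}"]) auto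
  moreover have "Q \<subseteq> S"
  proof
    fix x assume x: "x \<in> Q"
    then have "x \<in> R" "x \<in> cbox a (\<chi> i. a $ i + l)"
      using QR a by auto
    then have "x $ i \<in> J i" "a $ i \<le> x $ i" "x $ i \<le> a $ i + l" for i
      by (auto simp: R_eq mem_box_cart)
    then have "x $ i \<in> J i" "c $ i \<le> x $ i" "x $ i \<le> c $ i + L / 2" for i
      using c[of i] by (meson order_trans)+
    then show "x \<in> S"
      unfolding S_def by auto
  qed
  moreover have "S \<subseteq> R"
    unfolding S_def R_eq by auto
  ultimately show ?thesis using that by blast
qed

lemma set_integral_wnorm_decay:
  fixes Q R :: "(real ^ 'n) set"
  assumes W: "matrix_weight W" and p: "0 < p" and Q: "cube_of_edge l Q" and R: "cube_of_edge L R"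
    and M: "M \<noteq> 0" and QR: "Q \<subseteq> R" and lL: "2 * l \<le> L"
    and K: "1 \<le> K" "exp_log_avg p W R R \<le> ereal K"
  shows "(LINT x:Q|lebesgue. wnorm p W M x) \<le>
    (1 - exp (- (2 * ln K + 4))) * (LINT x:R|lebesgue. wnorm p W M x)"
proof (rule ccontr)
  define g where "g = wnorm p W M"
  \<comment> \<open>Chosen so that \<open>1 - ln s = 2 * ln K + 5\<close>; half of this already
    exceeds \<open>ln K + 2\<close>, as the final comparison requires.\<close>
  define s where "s = exp (- (2 * ln K + 4))"
  define mR where "mR = measure lebesgue R"
  define mQ where "mQ = measure lebesgue Q"
  define IR where "IR = (LINT x:R|lebesgue. g x)"
  define IQ where "IQ = (LINT x:Q|lebesgue. g x)"
  define b where "b = IR / mR"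
  assume "\<not> ?thesis"
  then have contra: "(1 - s) * IR < IQ"
    by (simp add: IR_def IQ_def g_def s_def)
  have Qm: "Q \<in> lmeasurable" and Rm: "R \<in> lmeasurable"
    by (rule cube_measure(1), fact)+
  then have RQm: "R - Q \<in> lmeasurable"
    by (rule fmeasurable.Diff[rotated])
  have mR: "0 < mR"
    unfolding mR_def by (rule cube_measure_pos[OF R])
  have IR: "0 < IR"
    unfolding IR_def g_def by (rule set_integral_wnorm_pos[OF W p R M])
  have b: "0 < b"
    using IR mR by (simp add: b_def)
  have s: "0 < s" by (simp add: s_def)
  have gi: "set_integrable lebesgue E g" if "E \<in> lmeasurable" "bounded E" for E
    unfolding g_def using that by (rule wnorm_integrable[OF W p])
  have bd: "bounded Q" "bounded (R - Q)"
    using cube_measure(3)[OF Q] cube_measure(3)[OF R] by (auto intro: bounded_subset)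
  have gQ: "set_integrable lebesgue Q g" and gRQ: "set_integrable lebesgue (R - Q) g"
    by (intro gi Qm RQm bd)+
  have R_eq: "R = Q \<union> (R - Q)"
    using QR by auto
  have IRQ: "(LINT x:R - Q|lebesgue. g x) = IR - IQ"
    unfolding IR_def IQ_def by (subst R_eq, subst set_integral_Un) (use gQ gRQ in auto)
  have mRQ: "measure lebesgue (R - Q) = mR - mQ"
    unfolding mR_def mQ_def using Qm Rm QR by (simp add: measurable_measure_Diff fmeasurableD)
  \<comment> \<open>Halving the edge divides the volume by at least 2, since the dimension is at
    least 1.\<close>
  have half: "2 * mQ \<le> mR"
  proof -
    have l: "0 < l" using Q by (simp add: cube_of_edge_def)
    have "2 * l ^ CARD('n) \<le> (2 * l) ^ CARD('n)"
      using l by (simp add: power_mult_distrib self_le_power)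
    also have "\<dots> \<le> L ^ CARD('n)"
      using l lL by (intro power_mono) auto
    finally show ?thesis
      by (simp add: mQ_def mR_def cube_measure(2)[OF Q] cube_measure(2)[OF R])
  qed
  \<comment> \<open>Both branches are tangent line bounds for \<open>ln (b / g z)\<close>, taken at \<open>g z = b\<close> and at \<open>g z = b s\<close>.\<close>
  define h where "h z = (if z \<in> Q then 1 - g z / b else 1 - ln s - g z / (b * s))" for z
  have cQ: "set_integrable lebesgue Q (\<lambda>_. 1 :: real)"
    and cRQ: "set_integrable lebesgue (R - Q) (\<lambda>_. 1 - ln s)"
    by (intro set_integrable_const_lmeasurable Qm RQm)+
  have gQ': "set_integrable lebesgue Q (\<lambda>z. g z / b)"
    and gRQ': "set_integrable lebesgue (R - Q) (\<lambda>z. g z / (b * s))"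
    using gQ gRQ b s by simp_all
  have hQ: "set_integrable lebesgue Q h"
    using set_integral_diff(1)[OF cQ gQ'] by (rule set_integrable_cong[THEN iffD1, rotated -1]) (auto simp: h_def)
  have hRQ: "set_integrable lebesgue (R - Q) h"
    using set_integral_diff(1)[OF cRQ gRQ'] by (rule set_integrable_cong[THEN iffD1, rotated -1]) (auto simp: h_def)
  have hR: "set_integrable lebesgue R h"
    by (subst R_eq, rule set_integrable_Un[OF hQ hRQ]) (use Qm RQm in auto)
  have "(LINT z:Q|lebesgue. h z) = (LINT z:Q|lebesgue. 1 - g z / b)"
    using Qm by (intro set_lebesgue_integral_cong) (auto simp: h_def)
  also have "\<dots> = mQ - IQ / b"
    unfolding set_integral_diff(2)[OF cQ gQ'] set_integral_const_lmeasurable[OF Qm]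
    by (simp add: mQ_def IQ_def)
  finally have 1: "(LINT z:Q|lebesgue. h z) = mQ - IQ / b" .
  have "(LINT z:R - Q|lebesgue. h z) = (LINT z:R - Q|lebesgue. 1 - ln s - g z / (b * s))"
    using RQm by (intro set_lebesgue_integral_cong) (auto simp: h_def)
  also have "\<dots> = (1 - ln s) * (mR - mQ) - (IR - IQ) / (b * s)"
    unfolding set_integral_diff(2)[OF cRQ gRQ'] set_integral_const_lmeasurable[OF RQm]
    by (simp add: mRQ IRQ)
  finally have 2: "(LINT z:R - Q|lebesgue. h z) = (1 - ln s) * (mR - mQ) - (IR - IQ) / (b * s)" .
  have "(LINT z:R|lebesgue. h z) = (LINT z:Q|lebesgue. h z) + (LINT z:R - Q|lebesgue. h z)"
    by (subst R_eq, subst set_integral_Un) (use hQ hRQ in auto)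
  then have 3: "(LINT z:R|lebesgue. h z) = mQ - IQ / b + ((1 - ln s) * (mR - mQ) - (IR - IQ) / (b * s))"
    by (simp add: 1 2)
  have le: "AE z in lebesgue. z \<in> R \<longrightarrow> h z \<le> ln (cube_avg p W R z)"
    using matrix_weight_AE_invertible[OF W]
  proof eventually_elim
    case (elim z)
    have "set_avg R (wnorm p W M) = b"
      by (simp add: set_avg_def b_def IR_def mR_def g_def)
    then have *: "ln (b / c) + 1 - g z / c \<le> ln (cube_avg p W R z)" if "0 < c" for c
      using ln_cube_avg_ge[OF W p R M elim that] by (simp add: g_def)
    from *[OF b] *[of "b * s"] show ?case
      using b s by (auto simp: h_def ln_mult ln_div)
  qed
  have "ereal (LINT z:R|lebesgue. h z) \<le> ext_integral lebesgue R (\<lambda>z. ln (cube_avg p W R z))"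
    by (rule ext_integral_ge[OF hR le])
  also have "\<dots> \<le> ereal (ln K * mR)"
    using K(2) exp_log_avg_le_iff[of K R p W R] K(1) mR by (simp add: mR_def)
  finally have up: "(LINT z:R|lebesgue. h z) \<le> ln K * mR" by simp
  have "IR - IQ \<le> s * IR"
    using contra by (simp add: algebra_simps)
  then have "(IR - IQ) / (b * s) \<le> s * IR / (b * s)"
    using b s by (intro divide_right_mono) auto
  \<comment> \<open>The assumed smallness of the integral over \<open>R - Q\<close> compensates for
    the factor \<open>1 / s\<close> in the steeper tangent.\<close>
  then have A1: "(IR - IQ) / (b * s) \<le> mR"
    using b s IR mR by (simp add: b_def)
  have "0 \<le> (LINT x:R - Q|lebesgue. g x)"
    unfolding set_lebesgue_integral_def g_def by (rule integral_nonneg_AE) auto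
  then have "IQ / b \<le> IR / b"
    using b unfolding IRQ by (intro divide_right_mono) auto
  then have A2: "IQ / b \<le> mR"
    using b IR mR by (simp add: b_def)
  \<comment> \<open>The logarithmic term contributes at least \<open>(ln K + 5 / 2) * mR\<close>,
    while the two terms with \<open>g\<close> cost at most \<open>2 * mR\<close>. The sum exceeds
    the upper bound \<open>ln K * mR\<close>.\<close>
  have "(2 * ln K + 5) * (mR / 2) \<le> (2 * ln K + 5) * (mR - mQ)"
    using half ln_ge_zero[OF K(1)] by (intro mult_left_mono) auto
  moreover have "1 - ln s = 2 * ln K + 5"
    by (simp add: s_def)
  ultimately have "(2 * ln K + 5) * (mR / 2) \<le> (1 - ln s) * (mR - mQ)"
    by (simp only:)
  moreover have "(2 * ln K + 5) * (mR / 2) = ln K * mR + 5 / 2 * mR"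
    by (simp add: algebra_simps)
  moreover have "0 \<le> mQ"
    by (simp add: mQ_def)
  ultimately show False
    using up A1 A2 mR unfolding 3 by linarith
qed

lemma set_integral_wnorm_mono:
  assumes W: "matrix_weight W" and p: "0 < p" and Q: "cube_of_edge l Q" and R: "cube_of_edge L R"
    and QR: "Q \<subseteq> R"
  shows "(LINT x:Q|lebesgue. wnorm p W M x) \<le> (LINT x:R|lebesgue. wnorm p W M x)"
  unfolding set_lebesgue_integral_def
  using wnorm_integrable_cube[OF W p Q] wnorm_integrable_cube[OF W p R] QR
  by (intro integral_mono) (auto simp: set_integrable_def split: split_indicator)

text \<open>\<open>Q\<close> stays fixed while the outer cube shrinks: one factor is gained between
  \<open>R\<close> and a cube of half its edge around \<open>Q\<close>, and the induction hypothesis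
  treats the latter.\<close>

lemma set_integral_wnorm_decay_power:
  fixes Q R :: "(real ^ 'n) set"
  assumes W: "matrix_weight W" and p: "0 < p" and Q: "cube_of_edge l Q" and M: "M \<noteq> 0"
    and K: "1 \<le> K" "\<And>R. is_cube R \<Longrightarrow> exp_log_avg p W R R \<le> ereal K"
    and R: "cube_of_edge L R" and QR: "Q \<subseteq> R" and lL: "2 ^ k * l \<le> L"
  shows "(LINT x:Q|lebesgue. wnorm p W M x) \<le>
    (1 - exp (- (2 * ln K + 4))) ^ k * (LINT x:R|lebesgue. wnorm p W M x)"
  using R QR lL
proof (induction k arbitrary: L R)
  case 0
  then show ?case
    using set_integral_wnorm_mono[OF W p Q] by simp
next
  case (Suc k)
  define \<theta> where "\<theta> = 1 - exp (- (2 * ln K + 4))"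
  have "exp (- (2 * ln K + 4)) \<le> exp 0"
    using ln_ge_zero[OF K(1)] by (subst exp_le_cancel_iff) simp
  then have \<theta>: "0 \<le> \<theta>"
    by (simp add: \<theta>_def)
  have l: "0 < l"
    using Q by (simp add: cube_of_edge_def)
  have "1 * l \<le> 2 ^ k * l"
    using l by (intro mult_right_mono) auto
  then have "2 * l \<le> L"
    using Suc.prems(3) by simp
  then obtain S where S: "cube_of_edge (L / 2) S" "Q \<subseteq> S" "S \<subseteq> R"
    using intermediate_cube[OF Q Suc.prems(1,2)] by blast
  have "(LINT x:Q|lebesgue. wnorm p W M x) \<le> \<theta> ^ k * (LINT x:S|lebesgue. wnorm p W M x)"
    unfolding \<theta>_def using Suc.prems(3) by (intro Suc.IH[OF S(1,2)]) simp
  also have "\<dots> \<le> \<theta> ^ k * (\<theta> * (LINT x:R|lebesgue. wnorm p W M x))"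
    unfolding \<theta>_def
    using \<theta> Suc.prems(1) K
    by (intro mult_left_mono set_integral_wnorm_decay[OF W p S(1) Suc.prems(1) M S(3)])
      (auto simp: is_cube_def \<theta>_def)
  finally show ?case
    by (simp add: \<theta>_def mult.assoc mult.left_commute)
qed

section \<open>Inclusions between the classes\<close>

lemma A_p_infty_bounded:
  assumes "W \<in> A_p_infty p"
  obtains K where "1 \<le> K" "\<And>R. is_cube R \<Longrightarrow> exp_log_avg p W R R \<le> ereal K"
proof -
  have fin: "A_p_infty_const p W < \<infinity>"
    using assms by (simp add: A_p_infty_def)
  have le: "exp_log_avg p W R R \<le> A_p_infty_const p W" if "is_cube R" for R
    unfolding A_p_infty_const_def using that by (intro SUP_upper) simp
  \<comment> \<open>The maximum ensures \<open>0 \<le> ln K\<close> and also covers the value minus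
    infinity, which \<open>real_of_ereal\<close> sends to 0.\<close>
  define K where "K = max 1 (real_of_ereal (A_p_infty_const p W))"
  have "A_p_infty_const p W \<le> ereal K"
    using fin by (cases "A_p_infty_const p W") (auto simp: K_def)
  then show ?thesis
    using that[of K] le by (force simp: K_def intro: order_trans)
qed

lemma mat_1_nonzero: "(mat 1 :: complex ^ 'm ^ 'm) \<noteq> 0"
proof
  assume "(mat 1 :: complex ^ 'm ^ 'm) = 0"
  then have "(mat 1 :: complex ^ 'm ^ 'm) $ i $ i = 0" for i
    by simp
  then show False
    by (simp add: mat_def)
qed

text \<open>Membership in the class controls the positive part. From below, the tangent line bound
  with \<open>M = mat 1\<close> supplies an integrable minorant.\<close>

lemma ln_cube_avg_integrable:
  assumes WA: "W \<in> A_p_infty p" and p: "0 < p" and R: "cube_of_edge L R"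
  shows "set_integrable lebesgue R (\<lambda>y. ln (cube_avg p W R y))"
proof -
  have W: "matrix_weight W"
    and pos: "set_integrable lebesgue R (\<lambda>y. max 0 (ln (cube_avg p W R y)))"
    using WA R by (auto simp: A_p_infty_def is_cube_def)
  define g where "g = wnorm p W (mat 1)"
  define b where "b = set_avg R g"
  have b: "0 < b"
    unfolding b_def g_def by (rule set_avg_wnorm_pos[OF W p R mat_1_nonzero])
  have "set_integrable lebesgue R (\<lambda>z. 1 - g z / b)"
    using b wnorm_integrable_cube[OF W p R]
    by (intro set_integral_diff set_integrable_const_lmeasurable cube_measure(1)[OF R]) (auto simp: g_def)
  then have "set_integrable lebesgue R (\<lambda>z. \<bar>1 - g z / b\<bar>)"
    by (rule set_integrable_abs)
  with pos have "set_integrable lebesgue R (\<lambda>y. max 0 (ln (cube_avg p W R y)) + \<bar>1 - g y / b\<bar>)"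
    by (rule set_integral_add)
  then show ?thesis
  proof (rule set_integrable_bound)
    have "(\<lambda>y. ln (cube_avg p W R y)) \<in> borel_measurable lebesgue"
      using cube_avg_measurable[OF W p cube_measure(1)[OF R]] by (rule borel_measurable_ln)
    then show "set_borel_measurable lebesgue R (\<lambda>y. ln (cube_avg p W R y))"
      unfolding set_borel_measurable_def
      using cube_measure(1)[OF R] by (intro borel_measurable_scaleR borel_measurable_indicator) auto
    show "AE y in lebesgue. y \<in> R \<longrightarrow> norm (ln (cube_avg p W R y))
        \<le> norm (max 0 (ln (cube_avg p W R y)) + \<bar>1 - g y / b\<bar>)"
      using matrix_weight_AE_invertible[OF W]
    proof eventually_elim
      case (elim y)
      have "1 - g y / b \<le> ln (cube_avg p W R y)"
        using ln_cube_avg_ge[OF W p R mat_1_nonzero elim b] b by (simp add: g_def b_def)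
      then show ?case by auto
    qed
  qed
qed

text \<open>This rule and the elimination rule after it trade \<open>edge_length\<close> for
  explicit edges, so that the later arguments work with \<open>cube_of_edge\<close>.\<close>

lemma D_lowerI:
  fixes W :: "real ^ 'n \<Rightarrow> complex ^ 'm ^ 'm"
  assumes "matrix_weight W" "0 < C"
    and "\<And>l L Q R. cube_of_edge l Q \<Longrightarrow> cube_of_edge L R \<Longrightarrow> Q \<subseteq> R \<Longrightarrow>
      exp_log_avg p W Q R \<le> ereal (C * (L / l) powr d)"
  shows "W \<in> D_lower p d"
proof -
  have "exp_log_avg p W Q R \<le> ereal (C * (edge_length R / edge_length Q) powr d)"
    if QR: "is_cube Q" "is_cube R" "Q \<subseteq> R" for Q R
  proof -
    obtain l L where "cube_of_edge l Q" "cube_of_edge L R"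
      using QR by (auto simp: is_cube_def)
    then show ?thesis
      using assms(3)[of l Q L R] QR(3) by (simp add: edge_length_eq)
  qed
  then show ?thesis
    using assms(1,2) by (auto simp: D_lower_def)
qed

lemma D_lowerE:
  fixes W :: "real ^ 'n \<Rightarrow> complex ^ 'm ^ 'm"
  assumes "W \<in> D_lower p d"
  obtains C where "matrix_weight W" "0 < C"
    "\<And>l L Q R. cube_of_edge l Q \<Longrightarrow> cube_of_edge L R \<Longrightarrow> Q \<subseteq> R \<Longrightarrow>
      exp_log_avg p W Q R \<le> ereal (C * (L / l) powr d)"
proof -
  obtain C where C: "matrix_weight W" "0 < C"
    "\<And>Q R. is_cube Q \<Longrightarrow> is_cube R \<Longrightarrow> Q \<subseteq> R \<Longrightarrow>
      exp_log_avg p W Q R \<le> ereal (C * (edge_length R / edge_length Q) powr d)"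
    using assms by (auto simp: D_lower_def)
  show ?thesis
    using C(3) by (intro that[OF C(1,2)]) (metis edge_length_eq is_cube_def)
qed

lemma D_lower_mono:
  assumes "d1 \<le> d2"
  shows "D_lower p d1 \<subseteq> (D_lower p d2 :: (real ^ 'n \<Rightarrow> complex ^ 'm ^ 'm) set)"
proof
  fix W :: "real ^ 'n \<Rightarrow> complex ^ 'm ^ 'm"
  assume "W \<in> D_lower p d1"
  then obtain C where W: "matrix_weight W" and C: "0 < C"
    and le: "\<And>l L Q R. cube_of_edge l Q \<Longrightarrow> cube_of_edge L R \<Longrightarrow> Q \<subseteq> R \<Longrightarrow>
      exp_log_avg p W Q R \<le> ereal (C * (L / l) powr d1)"
    by (rule D_lowerE) (rule that)
  show "W \<in> D_lower p d2"
  proof (rule D_lowerI[OF W C])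
    fix l L and Q R :: "(real ^ 'n) set"
    assume Q: "cube_of_edge l Q" and R: "cube_of_edge L R" and QR: "Q \<subseteq> R"
    have "0 < l" "l \<le> L"
      using Q cube_edge_mono[OF Q R QR] by (auto simp: cube_of_edge_def)
    then have "(L / l) powr d1 \<le> (L / l) powr d2"
      using assms by (intro powr_mono) auto
    then have "ereal (C * (L / l) powr d1) \<le> ereal (C * (L / l) powr d2)"
      using C by (simp add: mult_left_mono)
    then show "exp_log_avg p W Q R \<le> ereal (C * (L / l) powr d2)"
      using le[OF Q R QR] by (rule order_trans[rotated])
  qed
qed

text \<open>For equal cubes the ratio of edges is 1, so \<open>C\<close> bounds the exponential
  averages whatever \<open>d\<close> is. Their finiteness also gives the integrability of the
  positive part.\<close>

lemma D_lower_subset_A_p_infty: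
  assumes p: "0 < p"
  shows "D_lower p d \<subseteq> (A_p_infty p :: (real ^ 'n \<Rightarrow> complex ^ 'm ^ 'm) set)"
proof
  fix W :: "real ^ 'n \<Rightarrow> complex ^ 'm ^ 'm"
  assume "W \<in> D_lower p d"
  then obtain C where W: "matrix_weight W" and C: "0 < C"
    and le: "\<And>l L Q R. cube_of_edge l Q \<Longrightarrow> cube_of_edge L R \<Longrightarrow> Q \<subseteq> R \<Longrightarrow>
      exp_log_avg p W Q R \<le> ereal (C * (L / l) powr d)"
    by (rule D_lowerE) (rule that)
  have le': "exp_log_avg p W Q Q \<le> ereal C" if "cube_of_edge l Q" for l Q
    using le[OF that that] that by (simp add: cube_of_edge_def)
  have "set_integrable lebesgue Q (\<lambda>y. max 0 (ln (cube_avg p W Q y)))" if cube: "is_cube Q"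
    for Q :: "(real ^ 'n) set"
  proof -
    obtain l where Q: "cube_of_edge l Q"
      using cube by (auto simp: is_cube_def)
    have "ext_integral lebesgue Q (\<lambda>y. ln (cube_avg p W Q y)) \<le> ereal (ln C * measure lebesgue Q)"
      using le'[OF Q] exp_log_avg_le_iff[OF C cube_measure_pos[OF Q]] by blast
    then have "ext_integral lebesgue Q (\<lambda>y. ln (cube_avg p W Q y)) < \<infinity>"
      by (rule order_le_less_trans) simp
    then show ?thesis
      using cube_avg_measurable[OF W p cube_measure(1)[OF Q]] cube_measure(1)[OF Q]
      by (intro set_integrable_pos_part_if_ext_integral borel_measurable_ln) auto
  qed
  moreover have "A_p_infty_const p W \<le> ereal C"
    unfolding A_p_infty_const_def using le' by (intro SUP_least) (auto simp: is_cube_def)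
  then have "A_p_infty_const p W < \<infinity>"
    by (rule order_le_less_trans) simp
  ultimately show "W \<in> A_p_infty p"
    using W by (simp add: A_p_infty_def)
qed

lemma A_p_infty_subset_D_lower:
  fixes W :: "real ^ 'n \<Rightarrow> complex ^ 'm ^ 'm"
  assumes WA: "W \<in> A_p_infty p" and p: "0 < p"
  shows "\<exists>d\<in>{0..<real CARD('n)}. W \<in> D_lower p d"
proof -
  have W: "matrix_weight W"
    using WA by (simp add: A_p_infty_def)
  obtain K where K: "1 \<le> K" "\<And>R. is_cube R \<Longrightarrow> exp_log_avg p W R R \<le> ereal K"
    using A_p_infty_bounded[OF WA] by blast
  define \<theta> where "\<theta> = 1 - exp (- (2 * ln K + 4))"
  \<comment> \<open>Aims at \<open>1 / 2 < \<theta>\<close>, which gives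
    \<open>- 1 < log 2 \<theta>\<close>; as the dimension is at least 1, \<open>d\<close> is then
    nonnegative.\<close>
  have "exp (- (2 * ln K + 4)) \<le> exp (-4)"
    using ln_ge_zero[OF K(1)] by (subst exp_le_cancel_iff) simp
  also have "\<dots> < 1 / 2"
    using exp_ge_add_one_self[of 4] by (simp add: exp_minus field_simps)
  finally have \<theta>: "1 / 2 < \<theta>" "\<theta> < 1"
    by (simp_all add: \<theta>_def)
  define n where "n = real CARD('n)"
  have n: "1 \<le> n"
    by (simp add: n_def Suc_le_eq)
  \<comment> \<open>The ratio of volumes contributes \<open>\<Lambda> powr n\<close>, and about
    \<open>log 2 \<Lambda>\<close> halvings contribute
    \<open>\<Lambda> powr log 2 \<theta>\<close>.\<close>
  define d where "d = n + log 2 \<theta>"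
  have "log 2 (1 / 2) < log 2 \<theta>" "log 2 \<theta> < log 2 1"
    using \<theta> by (simp_all del: log_one)
  then have \<theta>log: "- 1 < log 2 \<theta>" "log 2 \<theta> < 0"
    by (simp_all add: log_divide)
  then have d: "d \<in> {0..<n}"
    using n by (simp add: d_def)
  have "W \<in> D_lower p d"
  proof (rule D_lowerI[OF W, of "K / \<theta>"])
    show "0 < K / \<theta>" using K(1) \<theta> by simp
    fix l L and Q R :: "(real ^ 'n) set"
    assume Q: "cube_of_edge l Q" and R: "cube_of_edge L R" and QR: "Q \<subseteq> R"
    define \<Lambda> where "\<Lambda> = L / l"
    have l: "0 < l" and L: "0 < L"
      using Q R by (simp_all add: cube_of_edge_def)
    have \<Lambda>: "1 \<le> \<Lambda>"
      using cube_edge_mono[OF Q R QR] l by (simp add: \<Lambda>_def)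
    \<comment> \<open>Rounding down loses less than one halving, whence the divisor
      \<open>\<theta>\<close> in the constant \<open>K / \<theta>\<close>.\<close>
    define k where "k = nat \<lfloor>log 2 \<Lambda>\<rfloor>"
    have k: "real k \<le> log 2 \<Lambda>" "log 2 \<Lambda> - 1 \<le> real k"
      using \<Lambda> by (auto simp: k_def; linarith)+
    have "2 ^ k = 2 powr real k"
      by (simp add: powr_realpow)
    also have "\<dots> \<le> 2 powr log 2 \<Lambda>"
      using k by simp
    also have "\<dots> = \<Lambda>"
      using \<Lambda> by simp
    finally have kL: "2 ^ k * l \<le> L"
      using l by (simp add: \<Lambda>_def field_simps)
    have "\<theta> ^ k = \<theta> powr real k"
      using \<theta> by (simp add: powr_realpow)
    also have "\<dots> \<le> \<theta> powr (log 2 \<Lambda> - 1)"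
      using \<theta> k by (intro powr_mono') auto
    also have "\<dots> = \<Lambda> powr log 2 \<theta> / \<theta>"
    proof -
      \<comment> \<open>Both sides are
        \<open>exp (ln \<theta> * ln \<Lambda> / ln 2)\<close>.\<close>
      have "\<theta> powr log 2 \<Lambda> = \<Lambda> powr log 2 \<theta>"
        using \<theta> \<Lambda> by (simp add: powr_def log_def mult.commute)
      then show ?thesis
        using \<theta> by (simp add: powr_diff)
    qed
    finally have \<theta>k: "\<theta> ^ k \<le> \<Lambda> powr log 2 \<theta> / \<theta>" .
    define B where "B = \<Lambda> powr d / \<theta>"
    have B: "0 < B"
      using \<theta> \<Lambda> by (simp add: B_def)
    have mQ: "0 < measure lebesgue Q" and mR: "0 < measure lebesgue R"
      by (rule cube_measure_pos, fact)+
    have ratio: "measure lebesgue R / measure lebesgue Q = \<Lambda> powr n"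
      using l L unfolding cube_measure(2)[OF Q] cube_measure(2)[OF R] n_def
      by (simp add: powr_realpow \<Lambda>_def power_divide)
    have "ln (cube_avg p W Q y) \<le> ln B + ln (cube_avg p W R y)" if y: "invertible (W y)" for y
    proof -
      \<comment> \<open>With this \<open>M\<close> the scalar averages over \<open>Q\<close> and
        \<open>R\<close> become the inner averages at \<open>y\<close>, while
        \<open>\<theta>\<close> and \<open>k\<close> are independent of \<open>y\<close>.\<close>
      define M where "M = matrix_powr (W y) (- 1 / p)"
      have M: "M \<noteq> 0"
        unfolding M_def by (rule matrix_powr_nonzero[OF W y])
      have FQ: "0 < cube_avg p W Q y" and FR: "0 < cube_avg p W R y"
        unfolding cube_avg_eq M_def[symmetric] by (rule set_avg_wnorm_pos[OF W p _ M], fact)+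
      have "(LINT x:Q|lebesgue. wnorm p W M x) \<le> \<theta> ^ k * (LINT x:R|lebesgue. wnorm p W M x)"
        unfolding \<theta>_def by (rule set_integral_wnorm_decay_power[OF W p Q M K R QR kL])
      also have "(LINT x:R|lebesgue. wnorm p W M x) = measure lebesgue R * cube_avg p W R y"
        using mR by (simp add: cube_avg_eq set_avg_def M_def)
      finally have "cube_avg p W Q y \<le> \<theta> ^ k * (measure lebesgue R * cube_avg p W R y) / measure lebesgue Q"
        using mQ by (simp add: cube_avg_eq set_avg_def M_def divide_right_mono)
      also have "\<dots> = \<theta> ^ k * (\<Lambda> powr n * cube_avg p W R y)"
        unfolding ratio[symmetric] by simp
      also have "\<dots> \<le> (\<Lambda> powr log 2 \<theta> / \<theta>) * (\<Lambda> powr n * cube_avg p W R y)"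
        using FR by (intro mult_right_mono \<theta>k) auto
      also have "\<dots> = B * cube_avg p W R y"
        by (simp add: B_def d_def powr_add)
      finally have "ln (cube_avg p W Q y) \<le> ln (B * cube_avg p W R y)"
        using FQ by (intro ln_mono) auto
      then show ?thesis
        using B FR by (simp add: ln_mult)
    qed
    then have "AE y in lebesgue. y \<in> R \<longrightarrow> ln (cube_avg p W Q y) \<le> ln B + ln (cube_avg p W R y)"
      using matrix_weight_AE_invertible[OF W] by auto
    \<comment> \<open>The inner cube is now \<open>R\<close> instead of \<open>Q\<close>, so the
      bound \<open>K\<close> for \<open>R\<close> alone finishes the estimate.\<close>
    then have "ext_integral lebesgue R (\<lambda>y. ln (cube_avg p W Q y))
        \<le> ext_integral lebesgue R (\<lambda>y. ln B + ln (cube_avg p W R y))"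
      by (rule ext_integral_mono_AE)
    also have "\<dots> = ereal (LINT y:R|lebesgue. ln B + ln (cube_avg p W R y))"
      by (intro ext_integral_eq_set_integral set_integral_add set_integrable_const_lmeasurable
          cube_measure(1)[OF R] ln_cube_avg_integrable[OF WA p R])
    also have "(LINT y:R|lebesgue. ln B + ln (cube_avg p W R y))
        = ln B * measure lebesgue R + (LINT y:R|lebesgue. ln (cube_avg p W R y))"
      by (subst set_integral_add(2)[OF set_integrable_const_lmeasurable[OF cube_measure(1)[OF R]]
            ln_cube_avg_integrable[OF WA p R]])
        (simp add: set_integral_const_lmeasurable[OF cube_measure(1)[OF R]])
    also have "ereal \<dots> \<le> ereal (ln (K * B) * measure lebesgue R)"
    proof -
      have "exp_log_avg p W R R \<le> ereal K"
        using K(2) R by (auto simp: is_cube_def)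
      then have "ext_integral lebesgue R (\<lambda>y. ln (cube_avg p W R y)) \<le> ereal (ln K * measure lebesgue R)"
        using exp_log_avg_le_iff[of K R p W R] K(1) mR by simp
      then have "(LINT y:R|lebesgue. ln (cube_avg p W R y)) \<le> ln K * measure lebesgue R"
        unfolding ext_integral_eq_set_integral[OF ln_cube_avg_integrable[OF WA p R]] by simp
      then show ?thesis
        using K(1) B by (simp add: ln_mult algebra_simps)
    qed
    finally have "exp_log_avg p W Q R \<le> ereal (K * B)"
      using K(1) B mR by (subst exp_log_avg_le_iff) auto
    then show "exp_log_avg p W Q R \<le> ereal (K / \<theta> * (L / l) powr d)"
      by (simp add: B_def \<Lambda>_def)
  qed
  then show ?thesis
    using d by (auto simp: n_def)
qed

section \<open>Negative dimensions\<close>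

text \<open>Half-open factors let the halves of a cube partition it exactly, without shared
  faces.\<close>

definition half_open_cube :: "real ^ 'n \<Rightarrow> real \<Rightarrow> (real ^ 'n) set" where
  "half_open_cube a l = {x. \<forall>i. x $ i \<in> {a $ i ..< a $ i + l}}"

lemma cube_of_edge_half_open: "0 < l \<Longrightarrow> cube_of_edge l (half_open_cube a l)"
  unfolding cube_of_edge_def half_open_cube_def
  by (intro conjI exI[of _ a] exI[of _ "\<lambda>i. {a $ i ..< a $ i + l}"]) auto

lemma half_open_cube_halve:
  fixes a :: "real ^ 'n" and g :: "real ^ 'n \<Rightarrow> real"
  assumes l: "0 < l" and g: "\<And>l Q. cube_of_edge l Q \<Longrightarrow> set_integrable lebesgue Q g"
  shows "\<exists>b. half_open_cube b (l / 2) \<subseteq> half_open_cube a l \<and>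
    set_avg (half_open_cube a l) g \<le> set_avg (half_open_cube b (l / 2)) g"
proof -
  \<comment> \<open>\<open>S\<close> is the set of coordinates in which the upper half is taken, so
    the subsets of the index type enumerate all pieces.\<close>
  define c where "c S = (\<chi> i. if i \<in> S then a $ i + l / 2 else a $ i)" for S :: "'n set"
  define H where "H S = half_open_cube (c S) (l / 2)" for S
  have cube: "cube_of_edge (l / 2) (H S)" for S
    unfolding H_def using l by (intro cube_of_edge_half_open) simp
  have mem: "x \<in> H S \<longleftrightarrow> x \<in> half_open_cube a l \<and> S = {i. a $ i + l / 2 \<le> x $ i}" for x S
  proof -
    have "x \<in> H S \<longleftrightarrow> (\<forall>i. x $ i \<in> {a $ i ..< a $ i + l} \<and> (i \<in> S \<longleftrightarrow> a $ i + l / 2 \<le> x $ i))"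
      unfolding H_def half_open_cube_def c_def mem_Collect_eq
      by (intro all_cong1) (use l in auto)
    then show ?thesis
      by (auto simp: half_open_cube_def)
  qed
  have Un: "half_open_cube a l = (\<Union>S\<in>UNIV. H S)"
    using mem by auto
  have sum: "(LINT x:half_open_cube a l|lebesgue. g x) = (\<Sum>S\<in>UNIV. LINT x:H S|lebesgue. g x)"
    unfolding Un
    using g[OF cube] cube_measure(1)[OF cube]
    by (intro set_integral_finite_Union) (auto simp: disjoint_family_on_def mem)
  define I where "I = (LINT x:half_open_cube a l|lebesgue. g x)"
  \<comment> \<open>Pigeonhole: some piece carries at least its proportional share of the integral,
    so its average is at least that of the whole cube.\<close>
  have "\<exists>S. I / 2 ^ CARD('n) \<le> (LINT x:H S|lebesgue. g x)"
  proof (rule ccontr)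
    assume "\<nexists>S. I / 2 ^ CARD('n) \<le> (LINT x:H S|lebesgue. g x)"
    then have "(\<Sum>S\<in>UNIV. LINT x:H S|lebesgue. g x) < (\<Sum>S\<in>(UNIV :: 'n set set). I / 2 ^ CARD('n))"
      by (intro sum_strict_mono) (auto simp: not_le)
    also have "\<dots> = I"
      using card_Pow[of "UNIV :: 'n set"] by simp
    finally show False
      using sum by (simp add: I_def)
  qed
  then obtain S where S: "I / 2 ^ CARD('n) \<le> (LINT x:H S|lebesgue. g x)" ..
  have "set_avg (half_open_cube a l) g \<le> set_avg (H S) g"
    unfolding set_avg_def cube_measure(2)[OF cube] cube_measure(2)[OF cube_of_edge_half_open[OF l]]
    using S l by (simp add: I_def[symmetric] power_divide field_simps)
  moreover have "H S \<subseteq> half_open_cube a l"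
    using mem by auto
  ultimately show ?thesis
    by (auto simp: H_def)
qed

lemma half_open_cube_halve_iterate:
  fixes g :: "real ^ 'n \<Rightarrow> real"
  assumes g: "\<And>l Q. cube_of_edge l Q \<Longrightarrow> set_integrable lebesgue Q g"
  shows "\<exists>b. half_open_cube b (1 / 2 ^ k) \<subseteq> half_open_cube 0 1 \<and>
    set_avg (half_open_cube 0 1) g \<le> set_avg (half_open_cube b (1 / 2 ^ k)) g"
proof (induction k)
  case 0
  then show ?case by (intro exI[of _ 0]) simp
next
  case (Suc k)
  then obtain b where b: "half_open_cube b (1 / 2 ^ k) \<subseteq> half_open_cube 0 1"
    "set_avg (half_open_cube 0 1) g \<le> set_avg (half_open_cube b (1 / 2 ^ k)) g"
    by blast
  obtain c where c: "half_open_cube c (1 / 2 ^ k / 2) \<subseteq> half_open_cube b (1 / 2 ^ k)"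
    "set_avg (half_open_cube b (1 / 2 ^ k)) g \<le> set_avg (half_open_cube c (1 / 2 ^ k / 2)) g"
    using half_open_cube_halve[of "1 / 2 ^ k" g b] g by auto
  have "(1 :: real) / 2 ^ Suc k = 1 / 2 ^ k / 2"
    by simp
  then show ?case
    using b c by (metis order_trans)
qed

text \<open>For suitable cubes of edge \<open>1 / 2 ^ k\<close> in the unit cube the left-hand side
  is at least 1, while the bound decays geometrically because \<open>2 powr d < 1\<close>.\<close>

lemma D_lower_negative_empty:
  assumes p: "0 < p" and d: "d < 0"
  shows "D_lower p d = ({} :: (real ^ 'n \<Rightarrow> complex ^ 'm ^ 'm) set)"
proof (rule equals0I)
  fix W :: "real ^ 'n \<Rightarrow> complex ^ 'm ^ 'm"
  assume "W \<in> D_lower p d"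
  then obtain C where W: "matrix_weight W" and C: "0 < C"
    and le: "\<And>l L Q R. cube_of_edge l Q \<Longrightarrow> cube_of_edge L R \<Longrightarrow> Q \<subseteq> R \<Longrightarrow>
      exp_log_avg p W Q R \<le> ereal (C * (L / l) powr d)"
    by (rule D_lowerE) (rule that)
  define g where "g = wnorm p W (mat 1)"
  define R :: "(real ^ 'n) set" where "R = half_open_cube 0 1"
  have R: "cube_of_edge 1 R"
    unfolding R_def by (rule cube_of_edge_half_open) simp
  have "1 \<le> C * (2 powr d) ^ k" for k
  proof -
    obtain b where b: "half_open_cube b (1 / 2 ^ k) \<subseteq> R"
      "set_avg R g \<le> set_avg (half_open_cube b (1 / 2 ^ k)) g"
      using half_open_cube_halve_iterate[of g k] wnorm_integrable_cube[OF W p]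
      unfolding R_def g_def by blast
    define Q where "Q = half_open_cube b (1 / 2 ^ k)"
    have Q: "cube_of_edge (1 / 2 ^ k) Q"
      unfolding Q_def by (rule cube_of_edge_half_open) simp
    have "1 \<le> set_avg Q g / set_avg R g"
      using b set_avg_wnorm_pos[OF W p R mat_1_nonzero] by (simp add: Q_def g_def)
    then have "ereal 1 \<le> ereal (set_avg Q g / set_avg R g)"
      by simp
    also have "\<dots> \<le> exp_log_avg p W Q R"
      unfolding g_def by (rule exp_log_avg_ge[OF W p Q R mat_1_nonzero])
    also have "\<dots> \<le> ereal (C * (1 / (1 / 2 ^ k)) powr d)"
      using b(1) by (intro le[OF Q R]) (simp add: Q_def)
    also have "(1 / (1 / 2 ^ k)) powr d = (2 powr d) ^ k"
      by (simp add: powr_powr mult.commute flip: powr_realpow)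
    finally show ?thesis by simp
  qed
  moreover obtain k where "(2 powr d) ^ k < 1 / C"
    using real_arch_pow_inv[of "1 / C" "2 powr d"] C d powr_less_mono[of d 0 2] by auto
  ultimately show False
    using C by (simp add: field_simps not_le flip: not_less)
qed

section \<open>Power weights\<close>

text \<open>At the origin the convention \<open>0 powr x = 0\<close> replaces the singularity by 0,
  which alters the weight on a null set only.\<close>

definition norm_weight :: "real \<Rightarrow> real ^ 'n \<Rightarrow> real" where
  "norm_weight a x = norm x powr (- a)"

lemma norm_weight_nonneg [simp]: "0 \<le> norm_weight a x"
  by (simp add: norm_weight_def)

lemma norm_weight_measurable: "norm_weight a \<in> borel_measurable lebesgue"
proof -
  have "norm_weight a \<in> borel_measurable lborel"
    unfolding norm_weight_def[abs_def] by measurable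
  then show ?thesis
    by (rule measurable_completion)
qed

section \<open>Averages of a power of the norm\<close>

lemma norm_weight_le_dyadic_sum:
  fixes x :: "real ^ 'n"
  assumes a: "0 < a" and r: "0 < r" and x: "norm x \<le> r"
  shows "ennreal (norm_weight a x) \<le>
    (\<Sum>k. ennreal ((r / 2 ^ Suc k) powr (- a)) * indicator (cball 0 (r / 2 ^ k)) x)"
proof (cases "x = 0")
  case True
  then show ?thesis by (simp add: norm_weight_def)
next
  case False
  obtain j :: nat where "(1 / 2) ^ j < norm x / r"
    using real_arch_pow_inv[of "norm x / r" "1 / 2"] False r by auto
  then have ex: "r / 2 ^ j < norm x"
    using r by (simp add: power_one_over field_simps)
  \<comment> \<open>The least such index is not 0 because \<open>norm x \<le> r\<close>. Its
    predecessor fails the inequality, which places \<open>x\<close> in a dyadic shell where the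
    weight is at most its value at the inner radius.\<close>
  define j where "j = (LEAST j. r / 2 ^ j < norm x)"
  have j: "r / 2 ^ j < norm x"
    unfolding j_def using ex by (rule LeastI)
  obtain k where k: "j = Suc k"
    using j x by (cases j) auto
  have kx: "norm x \<le> r / 2 ^ k"
    using not_less_Least[of k "\<lambda>j. r / 2 ^ j < norm x"] k by (simp add: j_def)
  have "norm_weight a x \<le> (r / 2 ^ Suc k) powr (- a)"
    unfolding norm_weight_def using a r j k by (intro powr_mono2') auto
  define f where "f k = ennreal ((r / 2 ^ Suc k) powr (- a)) * indicator (cball 0 (r / 2 ^ k)) x" for k
  have "ennreal (norm_weight a x) \<le> f k"
    using \<open>norm_weight a x \<le> _\<close> kx by (simp add: f_def ennreal_leI)
  also have "f k = sum f {k}"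
    by simp
  also have "\<dots> \<le> suminf f"
    by (rule sum_le_suminf) auto
  finally show ?thesis
    by (simp only: f_def[abs_def])
qed

text \<open>Integrating the dyadic bound term by term gives a geometric series with ratio
  \<open>q = 2 powr (a - n)\<close>, which is less than 1 because \<open>a\<close> is below the
  dimension.\<close>

lemma nn_integral_norm_weight_cball:
  assumes a: "0 < a" "a < real CARD('n)"
  shows "\<exists>C\<ge>0. \<forall>r>0. (\<integral>\<^sup>+ x \<in> cball (0 :: real ^ 'n) r. ennreal (norm_weight a x) \<partial>lebesgue)
    \<le> ennreal (C * r powr (real CARD('n) - a))"
proof -
  define n where "n = real CARD('n)"
  define V where "V = unit_ball_vol n"
  define q where "q = 2 powr (a - n)"
  have q: "0 < q" "q < 1"
    using a powr_less_mono[of "a - n" 0 2] by (auto simp: q_def n_def)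
  have V: "0 \<le> V"
    unfolding V_def n_def by simp
  have em: "emeasure lebesgue (cball (0 :: real ^ 'n) s) = ennreal (V * s powr n)" if "0 < s" for s
  proof -
    have "emeasure lebesgue (cball (0 :: real ^ 'n) s) = emeasure lborel (cball (0 :: real ^ 'n) s)"
      by (subst emeasure_completion) (simp_all add: main_part_sets)
    also have "\<dots> = ennreal (V * s ^ CARD('n))"
      using that by (subst emeasure_cball) (simp_all add: V_def n_def)
    also have "s ^ CARD('n) = s powr n"
      unfolding n_def using that by (rule powr_realpow[symmetric])
    finally show ?thesis .
  qed
  have "(\<integral>\<^sup>+ x \<in> cball (0 :: real ^ 'n) r. ennreal (norm_weight a x) \<partial>lebesgue)
    \<le> ennreal (2 powr a * V / (1 - q) * r powr (n - a))" if r: "0 < r" for r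
  proof -
    have summand: "(r / 2 ^ Suc k) powr (- a) * (V * (r / 2 ^ k) powr n)
        = 2 powr a * V * r powr (n - a) * q ^ k" for k
    proof -
      have 1: "(r / 2 ^ i) powr b = r powr b * 2 powr (- real i * b)" for i b
        using r by (simp add: powr_divide powr_minus_divide powr_powr flip: powr_realpow)
      have 2: "q ^ k = 2 powr (real k * (a - n))"
        by (simp add: q_def powr_powr mult.commute flip: powr_realpow)
      have "- real (Suc k) * (- a) + - real k * n = a + real k * (a - n)"
        by (simp add: algebra_simps)
      then have 3: "2 powr (- real (Suc k) * (- a)) * 2 powr (- real k * n) = 2 powr a * 2 powr (real k * (a - n))"
        by (simp only: powr_add[symmetric])
      have 4: "r powr (n - a) = r powr (- a) * r powr n"
        by (simp flip: powr_add)
      show ?thesis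
        unfolding 1 2 4 using 3 by (simp add: mult_ac)
    qed
    have "(\<integral>\<^sup>+ x \<in> cball (0 :: real ^ 'n) r. ennreal (norm_weight a x) \<partial>lebesgue)
      \<le> (\<integral>\<^sup>+ x. (\<Sum>k. ennreal ((r / 2 ^ Suc k) powr (- a)) * indicator (cball (0 :: real ^ 'n) (r / 2 ^ k)) x) \<partial>lebesgue)"
    proof (rule nn_integral_mono)
      fix x :: "real ^ 'n"
      show "ennreal (norm_weight a x) * indicator (cball 0 r) x
          \<le> (\<Sum>k. ennreal ((r / 2 ^ Suc k) powr (- a)) * indicator (cball 0 (r / 2 ^ k)) x)"
        using norm_weight_le_dyadic_sum[OF a(1) r, of x] by (cases "x \<in> cball 0 r") simp_all
    qed
    also have "\<dots> = (\<Sum>k. \<integral>\<^sup>+ x. ennreal ((r / 2 ^ Suc k) powr (- a)) * indicator (cball (0 :: real ^ 'n) (r / 2 ^ k)) x \<partial>lebesgue)"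
      by (intro nn_integral_suminf borel_measurable_times_ennreal borel_measurable_const
          borel_measurable_indicator lmeasurable_cball[THEN fmeasurableD])
    also have "\<dots> = (\<Sum>k. ennreal ((r / 2 ^ Suc k) powr (- a) * (V * (r / 2 ^ k) powr n)))"
    proof (rule suminf_cong)
      fix k
      have "(\<integral>\<^sup>+ x. ennreal ((r / 2 ^ Suc k) powr (- a)) * indicator (cball (0 :: real ^ 'n) (r / 2 ^ k)) x \<partial>lebesgue)
          = ennreal ((r / 2 ^ Suc k) powr (- a)) * emeasure lebesgue (cball (0 :: real ^ 'n) (r / 2 ^ k))"
        by (intro nn_integral_cmult_indicator lmeasurable_cball[THEN fmeasurableD])
      also have "\<dots> = ennreal ((r / 2 ^ Suc k) powr (- a) * (V * (r / 2 ^ k) powr n))"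
        using r V by (subst em) (simp_all only: ennreal_mult powr_ge_zero mult_nonneg_nonneg zero_less_power zero_less_numeral zero_less_divide_iff simp_thms)
      finally show "(\<integral>\<^sup>+ x. ennreal ((r / 2 ^ Suc k) powr (- a)) * indicator (cball (0 :: real ^ 'n) (r / 2 ^ k)) x \<partial>lebesgue)
          = ennreal ((r / 2 ^ Suc k) powr (- a) * (V * (r / 2 ^ k) powr n))" .
    qed
    also have "\<dots> = (\<Sum>k. ennreal (2 powr a * V * r powr (n - a) * q ^ k))"
      unfolding summand ..
    also have "\<dots> = ennreal (2 powr a * V * r powr (n - a) * (1 / (1 - q)))"
      using q V by (intro suminf_ennreal_eq sums_mult geometric_sums) auto
    finally show ?thesis
      by (simp add: mult_ac)
  qed
  moreover have "0 \<le> 2 powr a * V / (1 - q)"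
    using V q by simp
  ultimately show ?thesis
    unfolding n_def by blast
qed

lemma norm_weight_integrable_bounded:
  fixes K :: "(real ^ 'n) set"
  assumes a: "0 < a" "a < real CARD('n)" and K: "K \<in> sets lebesgue" "bounded K"
  shows "set_integrable lebesgue K (norm_weight a)"
proof -
  obtain r where r: "0 < r" "\<forall>x\<in>K. norm x \<le> r"
    using K(2) unfolding bounded_pos by blast
  then have Kr: "K \<subseteq> cball 0 r"
    by auto
  have "(\<integral>\<^sup>+ x. ennreal (norm (indicator (cball (0 :: real ^ 'n) r) x *\<^sub>R norm_weight a x)) \<partial>lebesgue)
      = (\<integral>\<^sup>+ x \<in> cball (0 :: real ^ 'n) r. ennreal (norm_weight a x) \<partial>lebesgue)"
    by (intro nn_integral_cong) (auto split: split_indicator)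
  also have "\<dots> < \<infinity>"
  proof -
    obtain C where "(\<integral>\<^sup>+ x \<in> cball (0 :: real ^ 'n) r. ennreal (norm_weight a x) \<partial>lebesgue)
        \<le> ennreal (C * r powr (real CARD('n) - a))"
      using nn_integral_norm_weight_cball[OF a] r(1) by blast
    then show ?thesis
      by (rule order_le_less_trans) simp
  qed
  finally have "set_integrable lebesgue (cball (0 :: real ^ 'n) r) (norm_weight a)"
    unfolding set_integrable_def
    by (intro integrableI_bounded borel_measurable_scaleR borel_measurable_indicator norm_weight_measurable) auto
  then show ?thesis
    using K(1) Kr by (rule set_integrable_subset)
qed

text \<open>Split at distance \<open>l\<close> from the origin: outside that ball the weight is at
  most \<open>l powr (- a)\<close>, and inside it the integral over the whole ball has the same
  order after division by the volume. The position of \<open>Q\<close> does not enter.\<close>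

lemma set_avg_norm_weight_le:
  assumes a: "0 < a" "a < real CARD('n)"
  shows "\<exists>C\<ge>0. \<forall>l. \<forall>Q :: (real ^ 'n) set. cube_of_edge l Q \<longrightarrow> set_avg Q (norm_weight a) \<le> C * l powr (- a)"
proof -
  obtain C where C: "0 \<le> C" and ball: "\<And>r. 0 < r \<Longrightarrow>
    (\<integral>\<^sup>+ x \<in> cball (0 :: real ^ 'n) r. ennreal (norm_weight a x) \<partial>lebesgue) \<le> ennreal (C * r powr (real CARD('n) - a))"
    using nn_integral_norm_weight_cball[OF a] by blast
  have "set_avg Q (norm_weight a) \<le> (1 + C) * l powr (- a)" if Q: "cube_of_edge l Q"
    for l and Q :: "(real ^ 'n) set"
  proof -
    have l: "0 < l" using Q by (simp add: cube_of_edge_def)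
    let ?B = "cball (0 :: real ^ 'n) l"
    have iB: "integrable lebesgue (\<lambda>x. indicator ?B x *\<^sub>R norm_weight a x)"
      using norm_weight_integrable_bounded[OF a, of ?B] by (simp add: set_integrable_def)
    have iQ: "integrable lebesgue (\<lambda>x. indicator Q x *\<^sub>R norm_weight a x)"
      using norm_weight_integrable_bounded[OF a, of Q] cube_measure[OF Q] by (simp add: set_integrable_def fmeasurableD)
    have ic: "integrable lebesgue (\<lambda>x. indicator Q x *\<^sub>R l powr (- a))"
      using set_integrable_const_lmeasurable[OF cube_measure(1)[OF Q]] by (simp only: set_integrable_def)
    have "ennreal (\<integral>x. indicator ?B x *\<^sub>R norm_weight a x \<partial>lebesgue)
        = (\<integral>\<^sup>+ x. ennreal (indicator ?B x *\<^sub>R norm_weight a x) \<partial>lebesgue)"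
      by (rule nn_integral_eq_integral[symmetric, OF iB]) auto
    also have "\<dots> = (\<integral>\<^sup>+ x \<in> ?B. ennreal (norm_weight a x) \<partial>lebesgue)"
      by (intro nn_integral_cong) (auto split: split_indicator)
    also have "\<dots> \<le> ennreal (C * l powr (real CARD('n) - a))"
      by (rule ball[OF l])
    finally have B: "(\<integral>x. indicator ?B x *\<^sub>R norm_weight a x \<partial>lebesgue) \<le> C * l powr (real CARD('n) - a)"
      using C by (subst (asm) ennreal_le_iff) auto
    have "(LINT x:Q|lebesgue. norm_weight a x)
        \<le> (\<integral>x. indicator Q x *\<^sub>R l powr (- a) + indicator ?B x *\<^sub>R norm_weight a x \<partial>lebesgue)"
      unfolding set_lebesgue_integral_def
    proof (intro integral_mono iQ Bochner_Integration.integrable_add ic iB)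
      fix x :: "real ^ 'n"
      have "norm_weight a x \<le> l powr (- a)" if "x \<notin> ?B"
        unfolding norm_weight_def using that l a by (intro powr_mono2') auto
      then show "indicator Q x *\<^sub>R norm_weight a x
          \<le> indicator Q x *\<^sub>R l powr (- a) + indicator ?B x *\<^sub>R norm_weight a x"
        by (cases "x \<in> Q"; cases "x \<in> ?B") auto
    qed
    also have "\<dots> = l powr (- a) * measure lebesgue Q + (\<integral>x. indicator ?B x *\<^sub>R norm_weight a x \<partial>lebesgue)"
      using set_integral_const_lmeasurable[OF cube_measure(1)[OF Q], of "l powr (- a)"]
      unfolding set_lebesgue_integral_def by (subst Bochner_Integration.integral_add[OF ic iB]) (simp only:)
    also have "\<dots> \<le> l powr (- a) * measure lebesgue Q + C * l powr (real CARD('n) - a)"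
      using B by simp
    also have "l powr (real CARD('n) - a) = l powr (- a) * measure lebesgue Q"
      unfolding cube_measure(2)[OF Q] using l
      by (simp add: powr_realpow[symmetric] flip: powr_add)
    finally show ?thesis
      using cube_measure_pos[OF Q] by (simp add: set_avg_def field_simps)
  qed
  then show ?thesis
    using C by (intro exI[of _ "1 + C"]) auto
qed

lemma norm_cube_diff_le:
  fixes R :: "(real ^ 'n) set"
  assumes R: "cube_of_edge L R" and "x \<in> R" "y \<in> R"
  shows "norm (x - y) \<le> real CARD('n) * L"
proof -
  obtain a where "R \<subseteq> cbox a (\<chi> i. a $ i + L)"
    by (rule cube_of_edge_box[OF R])
  then have "a $ i \<le> x $ i" "x $ i \<le> a $ i + L" "a $ i \<le> y $ i" "y $ i \<le> a $ i + L" for i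
    using assms(2,3) by (auto simp: mem_box_cart subset_iff)
  then have "\<bar>(x - y) $ i\<bar> \<le> L" for i
    by (smt (verit) vector_minus_component)
  then have "(\<Sum>i\<in>UNIV. \<bar>(x - y) $ i\<bar>) \<le> (\<Sum>i\<in>(UNIV :: 'n set). L)"
    by (intro sum_mono)
  then show ?thesis
    using norm_le_l1_cart[of "x - y"] by simp
qed

lemma set_avg_norm_weight_times_le:
  assumes a: "0 < a" "a < real CARD('n)"
  shows "\<exists>B>0. \<forall>l L. \<forall>Q R :: (real ^ 'n) set. cube_of_edge l Q \<longrightarrow> cube_of_edge L R \<longrightarrow> Q \<subseteq> R \<longrightarrow>
    (\<forall>y\<in>R. set_avg Q (norm_weight a) * norm y powr a \<le> B * (L / l) powr a)"
proof -
  obtain C where C: "0 \<le> C" and avg: "\<And>l Q. cube_of_edge l (Q :: (real ^ 'n) set) \<Longrightarrow>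
    set_avg Q (norm_weight a) \<le> C * l powr (- a)"
    using set_avg_norm_weight_le[OF a] by blast
  define n where "n = real CARD('n)"
  \<comment> \<open>The second summand handles \<open>y\<close> within \<open>2 * n * L\<close> of
    the origin. The first handles distant \<open>y\<close>, where every point of \<open>R\<close>
    has norm at least \<open>norm y / 2\<close>.\<close>
  define B where "B = 2 powr a + C * (2 * n) powr a"
  have n: "0 < n" by (simp add: n_def)
  have B: "0 < B"
    using C by (simp add: B_def add_pos_nonneg)
  have "set_avg Q (norm_weight a) * norm y powr a \<le> B * (L / l) powr a"
    if Q: "cube_of_edge l Q" and R: "cube_of_edge L R" and QR: "Q \<subseteq> R" and y: "y \<in> R"
    for l L and Q R :: "(real ^ 'n) set" and y
  proof -
    have l: "0 < l" and L: "0 < L" and lL: "l \<le> L"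
      using Q R cube_edge_mono[OF Q R QR] by (auto simp: cube_of_edge_def)
    have mQ: "0 < measure lebesgue Q" by (rule cube_measure_pos[OF Q])
    show ?thesis
    proof (cases "norm y \<le> 2 * n * L")
      case True
      have "set_avg Q (norm_weight a) * norm y powr a \<le> (C * l powr (- a)) * (2 * n * L) powr a"
        using True avg[OF Q] a C by (intro mult_mono powr_mono2) auto
      also have "\<dots> = C * (2 * n) powr a * (L / l) powr a"
        using n l L by (simp add: powr_mult powr_divide powr_minus_divide)
      also have "\<dots> \<le> B * (L / l) powr a"
        by (intro mult_right_mono) (auto simp: B_def)
      finally show ?thesis .
    next
      case False
      then have ny: "2 * n * L < norm y" "0 < norm y"
        using n L by (auto intro: le_less_trans[of 0 "2 * n * L"])
      have "norm_weight a x \<le> (norm y / 2) powr (- a)" if "x \<in> Q" for x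
      proof -
        have "norm (y - x) \<le> n * L"
          unfolding n_def using that QR y by (intro norm_cube_diff_le[OF R]) auto
        then have "norm y / 2 \<le> norm x"
          using norm_triangle_sub[of y x] ny by linarith
        then show ?thesis
          unfolding norm_weight_def using a ny by (intro powr_mono2') auto
      qed
      then have "(LINT x:Q|lebesgue. norm_weight a x) \<le> (LINT x:Q|lebesgue. (norm y / 2) powr (- a))"
        using cube_measure[OF Q]
        by (intro set_integral_mono norm_weight_integrable_bounded[OF a] set_integrable_const_lmeasurable)
          (auto simp: fmeasurableD)
      then have "set_avg Q (norm_weight a) \<le> (norm y / 2) powr (- a)"
        using mQ unfolding set_integral_const_lmeasurable[OF cube_measure(1)[OF Q]]
        by (simp add: set_avg_def divide_simps)
      then have "set_avg Q (norm_weight a) * norm y powr a \<le> (norm y / 2) powr (- a) * norm y powr a"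
        by (intro mult_right_mono) auto
      also have "\<dots> = 2 powr a"
        using ny by (simp add: powr_divide powr_minus_divide)
      also have "\<dots> \<le> B * 1"
        using C by (simp add: B_def)
      also have "\<dots> \<le> B * (L / l) powr a"
        using B l lL a by (intro mult_left_mono ge_one_powr_ge_zero) auto
      finally show ?thesis .
    qed
  qed
  then show ?thesis using B by blast
qed

section \<open>Scalar matrices and power weights\<close>

lemma conj_transpose_mat_1: "conj_transpose (mat 1) = mat 1"
  by (simp add: conj_transpose_def mat_def vec_eq_iff)

lemma real_diag_eq_udiag: "real_diag f = udiag (mat 1) f"
  by (simp add: udiag_def conj_transpose_mat_1)

lemma unitary_mat_1: "unitary (mat 1)"
  by (simp add: unitary_def conj_transpose_mat_1)

lemma matrix_powr_scalar: "0 \<le> c \<Longrightarrow> matrix_powr (real_diag (\<lambda>_. c)) \<alpha> = real_diag (\<lambda>_. c powr \<alpha>)"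
  unfolding real_diag_eq_udiag by (rule matrix_powr_udiag[OF unitary_mat_1])

lemma scalar_mult: "real_diag (\<lambda>_. c) ** real_diag (\<lambda>_. d) = real_diag (\<lambda>_. c * d)"
  unfolding real_diag_eq_udiag by (rule udiag_mult[OF unitary_mat_1])

lemma scalar_mat_1: "real_diag (\<lambda>_. 1) = mat 1"
  unfolding real_diag_eq_udiag by (rule udiag_one[OF unitary_mat_1])

definition power_weight :: "real \<Rightarrow> real ^ 'n \<Rightarrow> complex ^ 'm ^ 'm" where
  "power_weight a x = real_diag (\<lambda>_. norm_weight a x)"

lemma matrix_weight_power_weight:
  assumes a: "0 < a" "a < real CARD('n)"
  shows "matrix_weight (power_weight a :: real ^ 'n \<Rightarrow> complex ^ 'm ^ 'm)"
proof -
  have "nonneg_definite (power_weight a x :: complex ^ 'm ^ 'm)" for x :: "real ^ 'n"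
  proof -
    have "cdot z (power_weight a x *v z) = of_real (norm_weight a x * (norm z)\<^sup>2)" for z :: "complex ^ 'm"
      by (simp add: power_weight_def scalar_matrix_vector cdot_scaleR_right cdot_self)
    then show ?thesis
      by (simp add: nonneg_definite_cdot)
  qed
  moreover have "AE x :: real ^ 'n in lebesgue. invertible (power_weight a x :: complex ^ 'm ^ 'm)"
  proof -
    have "AE x :: real ^ 'n in lebesgue. x \<noteq> 0"
      by (rule AE_completion[OF AE_lborel_singleton])
    then show ?thesis
    proof eventually_elim
      case (elim x)
      then have "norm_weight a x \<noteq> 0"
        by (simp add: norm_weight_def)
      then show ?case
        unfolding invertible_def power_weight_def
        by (intro exI[of _ "real_diag (\<lambda>_. 1 / norm_weight a x)"]) (simp add: scalar_mult scalar_mat_1)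
    qed
  qed
  moreover have "set_integrable lebesgue K (\<lambda>x. (power_weight a x :: complex ^ 'm ^ 'm) $ i $ j)"
    if "compact K" for i j and K :: "(real ^ 'n) set"
  proof (cases "i = j")
    case True
    have "set_integrable lebesgue K (norm_weight a)"
      using that by (intro norm_weight_integrable_bounded[OF a])
        (auto simp: compact_imp_bounded lmeasurable_compact fmeasurableD)
    then have "integrable lebesgue (\<lambda>x. complex_of_real (indicator K x *\<^sub>R norm_weight a x))"
      unfolding set_integrable_def by (rule integrable_of_real)
    then show ?thesis
      using True by (simp add: set_integrable_def power_weight_def real_diag_def scaleR_conv_of_real)
  next
    case False
    then show ?thesis
      by (simp add: set_integrable_def power_weight_def real_diag_def)
  qed
  ultimately show ?thesis
    by (simp add: matrix_weight_def)
qed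

lemma wnorm_power_weight_scalar:
  assumes p: "0 < p" and c: "0 \<le> c"
  shows "wnorm p (power_weight a) (real_diag (\<lambda>_. c)) x = norm_weight a x * c powr p"
  using p c
  by (simp add: wnorm_def power_weight_def matrix_powr_scalar scalar_mult op_norm_scalar powr_mult powr_powr)

lemma wnorm_power_weight:
  "0 < p \<Longrightarrow> wnorm p (power_weight a) (mat 1) x = norm_weight a x"
  using wnorm_power_weight_scalar[of p 1 a x] by (simp add: scalar_mat_1)

text \<open>For scalar weights the dependence on the two points separates. The convention
  \<open>0 powr x = 0\<close> makes the identity hold at \<open>y = 0\<close> too.\<close>

lemma cube_avg_power_weight:
  fixes Q :: "(real ^ 'n) set"
  assumes p: "0 < p"
  shows "cube_avg p (power_weight a :: real ^ 'n \<Rightarrow> complex ^ 'm ^ 'm) Q y = set_avg Q (norm_weight a) * norm y powr a"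
proof -
  have "norm_weight a y powr (- 1 / p) = norm y powr (a / p)"
    by (simp add: norm_weight_def powr_powr)
  then have "matrix_powr (power_weight a y :: complex ^ 'm ^ 'm) (- 1 / p) = real_diag (\<lambda>_. norm y powr (a / p))"
    by (simp add: power_weight_def matrix_powr_scalar)
  then have "wnorm p (power_weight a) (matrix_powr (power_weight a y :: complex ^ 'm ^ 'm) (- 1 / p)) x
      = norm_weight a x * norm y powr a" for x :: "real ^ 'n"
    using p by (simp add: wnorm_power_weight_scalar powr_powr)
  then show ?thesis
    by (simp add: cube_avg_eq set_avg_def)
qed

text \<open>The inner average is bounded by \<open>K\<close> at almost every point of
  \<open>R\<close>, and such a bound survives the outer logarithmic average.\<close>

lemma power_weight_in_D_lower:
  assumes p: "0 < p" and a: "0 < a" "a < real CARD('n)"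
  shows "(power_weight a :: real ^ 'n \<Rightarrow> complex ^ 'm ^ 'm) \<in> D_lower p a"
proof -
  let ?W = "power_weight a :: real ^ 'n \<Rightarrow> complex ^ 'm ^ 'm"
  have W: "matrix_weight ?W"
    by (rule matrix_weight_power_weight[OF a])
  obtain B where B: "0 < B" and le: "\<forall>l L. \<forall>Q R :: (real ^ 'n) set.
      cube_of_edge l Q \<longrightarrow> cube_of_edge L R \<longrightarrow> Q \<subseteq> R \<longrightarrow>
      (\<forall>y\<in>R. set_avg Q (norm_weight a) * norm y powr a \<le> B * (L / l) powr a)"
    using set_avg_norm_weight_times_le[OF a] by (elim exE conjE) (rule that)
  show ?thesis
  proof (rule D_lowerI[OF W B])
    fix l L and Q R :: "(real ^ 'n) set"
    assume Q: "cube_of_edge l Q" and R: "cube_of_edge L R" and QR: "Q \<subseteq> R"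
    define K where "K = B * (L / l) powr a"
    have K: "0 < K"
      using B Q R by (simp add: K_def cube_of_edge_def)
    have "ln (cube_avg p ?W Q y) \<le> ln K" if "y \<in> R" "invertible (?W y)" for y
    proof -
      have "0 < cube_avg p ?W Q y"
        unfolding cube_avg_eq by (rule set_avg_wnorm_pos[OF W p Q matrix_powr_nonzero[OF W that(2)]])
      then show ?thesis
        using le[rule_format, OF Q R QR that(1)] unfolding cube_avg_power_weight[OF p] K_def
        by (intro ln_mono) auto
    qed
    then have "AE y in lebesgue. y \<in> R \<longrightarrow> ln (cube_avg p ?W Q y) \<le> ln K"
      using matrix_weight_AE_invertible[OF W] by auto
    then have "ext_integral lebesgue R (\<lambda>y. ln (cube_avg p ?W Q y)) \<le> ext_integral lebesgue R (\<lambda>_. ln K)"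
      by (rule ext_integral_mono_AE)
    also have "\<dots> = ereal (ln K * measure lebesgue R)"
      unfolding ext_integral_eq_set_integral[OF set_integrable_const_lmeasurable[OF cube_measure(1)[OF R]]]
      by (simp only: set_integral_const_lmeasurable[OF cube_measure(1)[OF R]])
    finally have "exp_log_avg p ?W Q R \<le> ereal K"
      unfolding exp_log_avg_le_iff[OF K cube_measure_pos[OF R]] .
    then show "exp_log_avg p ?W Q R \<le> ereal (B * (L / l) powr a)"
      by (simp add: K_def)
  qed
qed

text \<open>Cubes cornered at the origin inside the unit cube: the average of the weight over an
  edge \<open>l\<close> is at least of order \<open>l powr (- a)\<close>, which outgrows
  \<open>l powr (- d)\<close> as \<open>l\<close> shrinks.\<close>

lemma power_weight_notin_D_lower:
  assumes p: "0 < p" and a: "0 < a" "a < real CARD('n)" and d: "d < a"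
  shows "(power_weight a :: real ^ 'n \<Rightarrow> complex ^ 'm ^ 'm) \<notin> D_lower p d"
proof
  let ?W = "power_weight a :: real ^ 'n \<Rightarrow> complex ^ 'm ^ 'm"
  have W: "matrix_weight ?W"
    by (rule matrix_weight_power_weight[OF a])
  assume "?W \<in> D_lower p d"
  then obtain C where C: "0 < C"
    and le: "\<And>l L Q R. cube_of_edge l Q \<Longrightarrow> cube_of_edge L R \<Longrightarrow> Q \<subseteq> R \<Longrightarrow>
      exp_log_avg p ?W Q R \<le> ereal (C * (L / l) powr d)"
    by (rule D_lowerE) (rule that)
  define n where "n = real CARD('n)"
  have n: "0 < n" by (simp add: n_def)
  define R :: "(real ^ 'n) set" where "R = half_open_cube 0 1"
  have R: "cube_of_edge 1 R"
    unfolding R_def by (rule cube_of_edge_half_open) simp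
  define A where "A = set_avg R (norm_weight a)"
  have wn: "wnorm p ?W (mat 1) = norm_weight a"
    using wnorm_power_weight[OF p] by blast
  have A: "0 < A"
    using set_avg_wnorm_pos[OF W p R mat_1_nonzero] by (simp add: wn A_def)
  define T where "T = C * A * n powr a"
  have T: "0 < T"
    using C A n by (simp add: T_def)
  \<comment> \<open>Solves \<open>l powr (d - a) = T + 1\<close>, whereas the assumed bound would
    give at most \<open>T\<close>.\<close>
  define l where "l = (T + 1) powr (- 1 / (a - d))"
  have l: "0 < l" "l \<le> 1"
    using T d powr_mono[of "- 1 / (a - d)" 0 "T + 1"] by (auto simp: l_def)
  have lT: "l powr (d - a) = T + 1"
  proof -
    have "- 1 / (a - d) * (d - a) = 1"
      using d by (simp add: field_simps)
    then show ?thesis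
      using T unfolding l_def powr_powr by simp
  qed
  define Q :: "(real ^ 'n) set" where "Q = half_open_cube 0 l"
  have Q: "cube_of_edge l Q"
    unfolding Q_def by (rule cube_of_edge_half_open[OF l(1)])
  have QR: "Q \<subseteq> R"
    using l(2) unfolding Q_def R_def half_open_cube_def
    by (auto intro: less_le_trans)
  have "0 \<in> Q"
    using l by (simp add: Q_def half_open_cube_def)
  \<comment> \<open>The origin has to be left out, since the weight takes the value 0 there.\<close>
  have "(n * l) powr (- a) \<le> norm_weight a x" if "x \<in> Q" "x \<noteq> 0" for x
    unfolding norm_weight_def
    using norm_cube_diff_le[OF Q that(1) \<open>0 \<in> Q\<close>] that(2) a by (intro powr_mono2') (auto simp: n_def)
  moreover have "AE x :: real ^ 'n in lebesgue. x \<noteq> 0"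
    by (rule AE_completion[OF AE_lborel_singleton])
  ultimately have ae: "AE x \<in> Q in lebesgue. (n * l) powr (- a) \<le> norm_weight a x"
    by auto
  have "(LINT x:Q|lebesgue. (n * l) powr (- a)) \<le> (LINT x:Q|lebesgue. norm_weight a x)"
    using wnorm_integrable_cube[OF W p Q, of "mat 1"] unfolding wn
    by (intro set_integral_mono_AE set_integrable_const_lmeasurable cube_measure(1)[OF Q] ae)
  then have "(n * l) powr (- a) \<le> set_avg Q (norm_weight a)"
    using cube_measure_pos[OF Q] unfolding set_integral_const_lmeasurable[OF cube_measure(1)[OF Q]]
    by (simp add: set_avg_def divide_simps)
  then have "(n * l) powr (- a) / A \<le> set_avg Q (norm_weight a) / A"
    using A by (intro divide_right_mono) auto
  then have "ereal ((n * l) powr (- a) / A) \<le> ereal (set_avg Q (norm_weight a) / A)"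
    by simp
  also have "\<dots> \<le> exp_log_avg p ?W Q R"
    using exp_log_avg_ge[OF W p Q R mat_1_nonzero] by (simp add: wn A_def)
  also have "\<dots> \<le> ereal (C * (1 / l) powr d)"
    by (rule le[OF Q R QR])
  finally have "(n * l) powr (- a) / A \<le> C * (1 / l) powr d"
    by simp
  then have "n powr (- a) * l powr (- a) \<le> C * A * (1 / l) powr d"
    using A l n by (simp add: powr_mult divide_le_eq mult_ac)
  also have "(1 / l) powr d = l powr (- d)"
    using l by (simp add: powr_divide powr_minus_divide)
  finally have le': "n powr (- a) * l powr (- a) \<le> C * A * l powr (- d)" .
  have nn: "n powr a * n powr (- a) = 1" and ll: "l powr d * l powr (- d) = 1"
    using n l by (simp_all flip: powr_add)
  have "T + 1 = (n powr a * n powr (- a)) * (l powr d * l powr (- a))"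
    using lT unfolding nn by (simp flip: powr_add)
  also have "\<dots> = (n powr (- a) * l powr (- a)) * (n powr a * l powr d)"
    by (simp only: mult_ac)
  also have "\<dots> \<le> (C * A * l powr (- d)) * (n powr a * l powr d)"
    using le' by (rule mult_right_mono) simp
  also have "\<dots> = C * A * n powr a * (l powr d * l powr (- d))"
    by (simp only: mult_ac)
  also have "\<dots> = T"
    by (simp add: ll T_def)
  finally show False by simp
qed

theorem proposition6p3:
  fixes p :: real
  assumes "0 < p"
  shows "(\<forall>d<0. D_lower p d = ({} :: (real ^ 'n \<Rightarrow> complex ^ 'm ^ 'm) set)) \<and>
    (\<Union>d\<in>{0..<real CARD('n)}. D_lower p d) = (A_p_infty p :: (real ^ 'n \<Rightarrow> complex ^ 'm ^ 'm) set) \<and>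
    (\<forall>d\<ge>real CARD('n). D_lower p d = (A_p_infty p :: (real ^ 'n \<Rightarrow> complex ^ 'm ^ 'm) set)) \<and>
    (\<forall>d1\<in>{0..real CARD('n)}. \<forall>d2\<in>{0..real CARD('n)}. d1 < d2 \<longrightarrow>
       D_lower p d1 \<subset> (D_lower p d2 :: (real ^ 'n \<Rightarrow> complex ^ 'm ^ 'm) set))"
proof (intro conjI allI ballI impI)
  fix d :: real
  assume "d < 0"
  then show "D_lower p d = ({} :: (real ^ 'n \<Rightarrow> complex ^ 'm ^ 'm) set)"
    by (rule D_lower_negative_empty[OF assms])
next
  show "(\<Union>d\<in>{0..<real CARD('n)}. D_lower p d) = (A_p_infty p :: (real ^ 'n \<Rightarrow> complex ^ 'm ^ 'm) set)"
    using D_lower_subset_A_p_infty[OF assms] A_p_infty_subset_D_lower[OF _ assms] by fast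
next
  fix d :: real
  assume d: "real CARD('n) \<le> d"
  show "D_lower p d = (A_p_infty p :: (real ^ 'n \<Rightarrow> complex ^ 'm ^ 'm) set)"
  proof (intro equalityI D_lower_subset_A_p_infty[OF assms] subsetI)
    fix W :: "real ^ 'n \<Rightarrow> complex ^ 'm ^ 'm"
    assume "W \<in> A_p_infty p"
    \<comment> \<open>The exponent just below the dimension found for \<open>W\<close> can be raised
      to any \<open>d\<close> in this range by monotonicity.\<close>
    then obtain d' where "d' < real CARD('n)" "W \<in> D_lower p d'"
      using A_p_infty_subset_D_lower[OF _ assms] by force
    then show "W \<in> D_lower p d"
      using D_lower_mono[of d' d p] d by auto
  qed
next
  fix d1 d2 :: real
  assume d: "d1 \<in> {0..real CARD('n)}" "d2 \<in> {0..real CARD('n)}" "d1 < d2"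
  \<comment> \<open>The midpoint lies strictly between 0 and the dimension even if \<open>d1\<close>
    and \<open>d2\<close> are the end points, so its power weight is locally integrable.\<close>
  define a where "a = (d1 + d2) / 2"
  have a: "0 < a" "a < real CARD('n)" "d1 < a" "a < d2"
    using d by (auto simp: a_def)
  show "D_lower p d1 \<subset> (D_lower p d2 :: (real ^ 'n \<Rightarrow> complex ^ 'm ^ 'm) set)"
  proof (rule psubsetI)
    show "D_lower p d1 \<subseteq> (D_lower p d2 :: (real ^ 'n \<Rightarrow> complex ^ 'm ^ 'm) set)"
      using d by (intro D_lower_mono) simp
    have "(power_weight a :: real ^ 'n \<Rightarrow> complex ^ 'm ^ 'm) \<in> D_lower p d2"
      using power_weight_in_D_lower[OF assms a(1,2)] D_lower_mono[of a d2 p] a(4) by auto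
    then show "D_lower p d1 \<noteq> (D_lower p d2 :: (real ^ 'n \<Rightarrow> complex ^ 'm ^ 'm) set)"
      using power_weight_notin_D_lower[OF assms a(1,2,3)] by metis
  qed
qed

end
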